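(* For every constant $C>1$ there exist $\varepsilon=\varepsilon(C)>0$ and $\ell_0=\ell_0(C)>0$ such that for all integers $\ell\ge\ell_0$, \[ r(\ell,C\ell)\ \ge\ (M_C+\varepsilon)^{\ell}, \] where $M_C=p_C^{-1/2}$ and $p_C\in(0,1/2)$ is the unique solution of $C=\frac{\log p_C}{\log(1-p_C)}$.
   Context: The Ramsey number $r(\ell,k)$ is the smallest positive integer $n$ such that every red-blue colouring of the edges of the complete graph $K_n$ contains a red $K_\ell$ or a blue $K_k$. Quantities such as $C\ell$ are treated as integers, as in the paper. Logarithms are natural. *)

theory Defs
  imports Complex_Main "HOL-Library.Ramsey"
begin

text \<open>Colour \<open>0\<close> is red and colour \<open>1\<close> is blue.\<close>

definition ramsey_number :: "nat \<Rightarrow> nat \<Rightarrow> nat" where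
  "ramsey_number l k = (LEAST n. n > 0 \<and> partn_lst {..<n} [l, k] 2)"

lemma ramsey_number_props:
  "ramsey_number l k > 0" "partn_lst {..<ramsey_number l k} [l, k] 2"
proof -
  obtain N :: nat where "partn_lst {..<N} [l, k] 2"
    using ramsey_full by metis
  then have "partn_lst {..<Suc N} [l, k] 2"
    by (rule partn_lst_greater_resource) simp
  then have "\<exists>n::nat. n > 0 \<and> partn_lst {..<n} [l, k] 2"
    by (intro exI[of _ "Suc N"]) simp
  then have "ramsey_number l k > 0 \<and> partn_lst {..<ramsey_number l k} [l, k] 2"
    unfolding ramsey_number_def by (rule LeastI_ex)
  then show "ramsey_number l k > 0" "partn_lst {..<ramsey_number l k} [l, k] 2"
    by auto
qed

definition p_val :: "real \<Rightarrow> real" where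
  "p_val C = (THE p. 0 < p \<and> p < 1/2 \<and> C = ln p / ln (1 - p))"

lemma p_val_ex1:
  fixes C :: real
  assumes "C > 1"
  shows "\<exists>!p. 0 < p \<and> p < 1/2 \<and> C = ln p / ln (1 - p)"
proof (rule ex_ex1I)
  define a where "a = exp (- 2 * C)"
  have "exp (2 * C) > 2"
    using exp_ge_add_one_self[of "2 * C"] assms by linarith
  then have a: "0 < a" "a < 1/2"
    by (auto simp: a_def exp_minus field_simps)
  let ?h = "\<lambda>p. C * ln (1 - p) - ln p"
  have "- ln 2 = ln (1/2 :: real)"
    by (simp add: ln_div)
  also have "\<dots> \<le> ln (1 - a)"
    using a by (subst ln_le_cancel_iff) auto
  finally have "- ln 2 \<le> ln (1 - a)" .
  moreover have "ln 2 \<le> (1 :: real)"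
    using ln_le_minus_one[of "2 :: real"] by simp
  ultimately have "C * ln (1 - a) \<ge> C * (- 1)"
    using assms by (intro mult_left_mono) auto
  then have ha: "?h a \<ge> 0"
    using assms by (simp add: a_def)
  have hb: "?h (1/2) < 0"
    using assms by (simp add: ln_div)
  have "continuous_on {a..1/2} ?h"
    using a by (intro continuous_intros) auto
  then obtain p where p: "a \<le> p" "p \<le> 1/2" "?h p = 0"
    using IVT2'[of ?h "1/2" 0 a] ha hb a by auto
  then have "p \<noteq> 1/2"
    using hb by (metis less_irrefl)
  with p a have "0 < p" "p < 1/2" "ln (1 - p) \<noteq> 0"
    by auto
  with p show "\<exists>p. 0 < p \<and> p < 1/2 \<and> C = ln p / ln (1 - p)"
    by (intro exI[of _ p]) (auto simp: field_simps)
next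
  have lt: "ln q / ln (1 - q) < ln p / ln (1 - p)" if "0 < p" "p < q" "q < 1/2" for p q :: real
  proof -
    have "(- ln q) * (- ln (1 - p)) < (- ln p) * (- ln (1 - q))"
      using that by (intro mult_strict_mono) auto
    moreover have "ln (1 - p) < 0" "ln (1 - q) < 0"
      using that by auto
    ultimately show ?thesis
      by (simp add: divide_simps mult.commute)
  qed
  fix p q :: real
  assume "0 < p \<and> p < 1/2 \<and> C = ln p / ln (1 - p)" "0 < q \<and> q < 1/2 \<and> C = ln q / ln (1 - q)"
  then show "p = q"
    using lt[of p q] lt[of q p] by (cases p q rule: linorder_cases) auto
qed

lemma p_val_props:
  assumes "C > 1"
  shows "0 < p_val C" "p_val C < 1/2" "C = ln (p_val C) / ln (1 - p_val C)"
  using theI'[OF p_val_ex1[OF assms]] by (auto simp: p_val_def)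

definition M_val :: "real \<Rightarrow> real" where
  "M_val C = p_val C powr (- 1/2)"

end

theory Submission
  imports Defs "HOL-Analysis.Analysis" "HOL-Real_Asymp.Real_Asymp"
begin

text \<open>
  Take independent uniform sign vectors \<open>x\<^sub>1, \<dots>, x\<^sub>n\<close> of dimension \<open>d = l\<^sup>2\<close> and, given these, colour the edge
  \<open>ij\<close> red independently with probability \<open>q (1 - u)\<close>, clipped to \<open>[0, 1]\<close>, where
  \<open>u = (\<eta>/l) \<langle>x\<^sub>i, x\<^sub>j\<rangle>\<close> and \<open>\<eta>\<close> is a small constant.  Negative correlation around triangles
  makes a red \<open>K\<^sub>l\<close> less likely than in the binomial random graph, by a factor \<open>exp (- \<eta>\<^sup>3 l\<^sup>2 / 6)\<close>,
  and a blue \<open>K\<^sub>k\<close> more likely, by \<open>exp (r\<^sup>3 \<eta>\<^sup>3 k\<^sup>3 / (6 l))\<close> with \<open>r = q / (1 - q)\<close>.  Since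
  \<open>C p\<^sup>2 < (1 - p)\<^sup>2\<close>, a shift \<open>q = p + t \<eta>\<^sup>3\<close> turns this into a gain for both colours, which absorbs the
  errors of order \<open>\<eta>\<^sup>4 l\<^sup>2\<close>.

  Both edge probabilities are bounded by multiples of \<open>\<Phi> (- u)\<close> and \<open>\<Phi> (r u)\<close>, where \<open>\<Phi> u \<ge> max 0 (1 + u)\<close>
  is a mixture of exponentials \<open>exp (g u)\<close>, \<open>g\<close> complex, with \<open>\<bbbE> g = 1\<close> and \<open>\<bbbE> g\<^sup>2 = 0\<close>.
  The expectation over the vectors of a product of exponentials of inner products factorises over the
  \<open>d\<close> coordinates; one factor is expanded to third order, and the average over the frequencies is
  controlled by bounded differences.
\<close>

section \<open>Expectation over finite product weights\<close>

text \<open>Values lie in an arbitrary real vector space, so that real and complex expectations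
  share one theory. The weights may depend on the coordinate because the random edges have different
  probabilities; normalisation is left to the locale \<open>weights\<close>.\<close>

definition pexp :: "'b set \<Rightarrow> ('a \<Rightarrow> 'b \<Rightarrow> real) \<Rightarrow> 'a set \<Rightarrow> (('a \<Rightarrow> 'b) \<Rightarrow> 'c::real_vector) \<Rightarrow> 'c" where
  "pexp B w A f = (\<Sum>x\<in>Pi\<^sub>E A (\<lambda>_. B). (\<Prod>a\<in>A. w a (x a)) *\<^sub>R f x)"

lemma pexp_cong:
  assumes "\<And>x. x \<in> Pi\<^sub>E A (\<lambda>_. B) \<Longrightarrow> f x = g x"
  shows "pexp B w A f = pexp B w A g"
  unfolding pexp_def using assms by (intro sum.cong) auto

lemma pexp_add: "pexp B w A (\<lambda>x. f x + g x) = pexp B w A f + pexp B w A g"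
  by (simp add: pexp_def scaleR_add_right sum.distrib)

lemma pexp_diff: "pexp B w A (\<lambda>x. f x - g x) = pexp B w A f - pexp B w A g"
  by (simp add: pexp_def scaleR_diff_right sum_subtractf)

lemma pexp_linear: "linear h \<Longrightarrow> pexp B w A (\<lambda>x. h (f x)) = h (pexp B w A f)"
  by (simp add: pexp_def linear_sum linear_scale)

lemma pexp_mult_left: "pexp B w A (\<lambda>x. c * f x) = c * pexp B w A f"
  for f :: "_ \<Rightarrow> 'c::real_algebra"
  by (rule pexp_linear) (auto intro!: linearI simp: algebra_simps)

lemma pexp_of_real: "pexp B w A (\<lambda>x. of_real (f x) :: 'c::real_algebra_1) = of_real (pexp B w A f)"
  by (rule pexp_linear) (auto intro!: linearI simp: scaleR_conv_of_real)

lemma pexp_sum: "pexp B w A (\<lambda>x. \<Sum>i\<in>I. f i x) = (\<Sum>i\<in>I. pexp B w A (f i))"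
  unfolding pexp_def scaleR_sum_right by (rule sum.swap)

lemma pexp_prod:
  fixes g :: "'a \<Rightarrow> 'b \<Rightarrow> 'c::{real_algebra_1,comm_ring_1}"
  assumes "finite A" "finite B"
  shows "pexp B w A (\<lambda>x. \<Prod>a\<in>A. g a (x a)) = (\<Prod>a\<in>A. \<Sum>b\<in>B. w a b *\<^sub>R g a b)"
  using assms by (subst prod_sum_PiE) (auto simp: pexp_def scaleR_conv_of_real prod.distrib)

text \<open>Conditioning on one coordinate; this recursion drives the inductions for bounded
  differences and for sign vectors.\<close>

lemma pexp_insert:
  assumes "finite A" "finite B" "a \<notin> A"
  shows "pexp B w (insert a A) f = (\<Sum>b\<in>B. w a b *\<^sub>R pexp B w A (\<lambda>x. f (x(a := b))))"
proof -
  have inj: "inj_on (\<lambda>(y, g). g(a := y)) (B \<times> Pi\<^sub>E A (\<lambda>_. B))"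
    using assms by (intro inj_combinator)
  have "pexp B w (insert a A) f =
      (\<Sum>(b, x)\<in>B \<times> Pi\<^sub>E A (\<lambda>_. B). (\<Prod>i\<in>insert a A. w i ((x(a := b)) i)) *\<^sub>R f (x(a := b)))"
    unfolding pexp_def PiE_insert_eq
    by (subst sum.reindex[OF inj]) (simp add: case_prod_unfold)
  also have "\<dots> = (\<Sum>(b, x)\<in>B \<times> Pi\<^sub>E A (\<lambda>_. B). w a b *\<^sub>R (\<Prod>i\<in>A. w i (x i)) *\<^sub>R f (x(a := b)))"
  proof (intro sum.cong refl, clarify)
    fix b x
    have "(\<Prod>i\<in>A. w i ((x(a := b)) i)) = (\<Prod>i\<in>A. w i (x i))"
      using assms by (intro prod.cong) auto
    then show "(\<Prod>i\<in>insert a A. w i ((x(a := b)) i)) *\<^sub>R f (x(a := b)) =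
        w a b *\<^sub>R (\<Prod>i\<in>A. w i (x i)) *\<^sub>R f (x(a := b))"
      using assms by simp
  qed
  also have "\<dots> = (\<Sum>b\<in>B. w a b *\<^sub>R pexp B w A (\<lambda>x. f (x(a := b))))"
    using assms by (simp add: pexp_def scaleR_sum_right sum.cartesian_product[symmetric] finite_PiE)
  finally show ?thesis .
qed

lemma pexp_sums:
  fixes f :: "nat \<Rightarrow> _ \<Rightarrow> 'c::real_normed_vector"
  assumes "\<And>x. x \<in> Pi\<^sub>E A (\<lambda>_. B) \<Longrightarrow> (\<lambda>j. f j x) sums g x"
  shows "(\<lambda>j. pexp B w A (f j)) sums pexp B w A g"
  unfolding pexp_def by (intro sums_sum sums_scaleR_right assms)

lemma pexp_swap:
  "pexp B w A (\<lambda>x. pexp B' w' A' (\<lambda>y. F x y)) = pexp B' w' A' (\<lambda>y. pexp B w A (\<lambda>x. F x y))"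
proof -
  have "pexp B w A (\<lambda>x. pexp B' w' A' (\<lambda>y. F x y))
      = (\<Sum>x\<in>Pi\<^sub>E A (\<lambda>_. B). \<Sum>y\<in>Pi\<^sub>E A' (\<lambda>_. B'). (\<Prod>a\<in>A. w a (x a)) *\<^sub>R (\<Prod>a\<in>A'. w' a (y a)) *\<^sub>R F x y)"
    by (simp add: pexp_def scaleR_sum_right)
  also have "\<dots> = (\<Sum>y\<in>Pi\<^sub>E A' (\<lambda>_. B'). \<Sum>x\<in>Pi\<^sub>E A (\<lambda>_. B). (\<Prod>a\<in>A'. w' a (y a)) *\<^sub>R (\<Prod>a\<in>A. w a (x a)) *\<^sub>R F x y)"
    by (subst sum.swap) (simp add: mult.commute)
  also have "\<dots> = pexp B' w' A' (\<lambda>y. pexp B w A (\<lambda>x. F x y))"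
    by (simp add: pexp_def scaleR_sum_right)
  finally show ?thesis .
qed

locale weights =
  fixes B :: "'b set" and w :: "'a \<Rightarrow> 'b \<Rightarrow> real" and A :: "'a set"
  assumes finite_B: "finite B" and finite_A: "finite A"
    and w_nonneg: "\<And>a b. a \<in> A \<Longrightarrow> b \<in> B \<Longrightarrow> 0 \<le> w a b"
    and w_sum: "\<And>a. a \<in> A \<Longrightarrow> (\<Sum>b\<in>B. w a b) = 1"
begin

lemma weight_nonneg: "x \<in> Pi\<^sub>E A (\<lambda>_. B) \<Longrightarrow> 0 \<le> (\<Prod>a\<in>A. w a (x a))"
  by (intro prod_nonneg) (auto intro!: w_nonneg)

lemma pexp_const: "pexp B w A (\<lambda>_. c) = c"
proof -
  have "(\<Sum>x\<in>Pi\<^sub>E A (\<lambda>_. B). \<Prod>a\<in>A. w a (x a)) = 1"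
    using pexp_prod[OF finite_A finite_B, of w "\<lambda>_ _. 1::real"] w_sum by (simp add: pexp_def)
  then show ?thesis
    by (simp add: pexp_def flip: scaleR_sum_left)
qed

lemma pexp_mono:
  fixes f g :: "_ \<Rightarrow> real"
  assumes "\<And>x. x \<in> Pi\<^sub>E A (\<lambda>_. B) \<Longrightarrow> f x \<le> g x"
  shows "pexp B w A f \<le> pexp B w A g"
  unfolding pexp_def using assms weight_nonneg by (intro sum_mono) (auto intro!: mult_left_mono)

lemma norm_pexp: "norm (pexp B w A f) \<le> pexp B w A (\<lambda>x. norm (f x))"
  for f :: "_ \<Rightarrow> 'c::real_normed_vector"
  unfolding pexp_def using weight_nonneg
  by (intro order.trans[OF norm_sum] sum_mono) auto

lemma norm_pexp_le:
  fixes f :: "_ \<Rightarrow> 'c::real_normed_vector"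
  assumes "\<And>x. x \<in> Pi\<^sub>E A (\<lambda>_. B) \<Longrightarrow> norm (f x) \<le> c"
  shows "norm (pexp B w A f) \<le> c"
  using norm_pexp[of f] pexp_mono[of "\<lambda>x. norm (f x)" "\<lambda>_. c"] assms pexp_const[of c] by simp

text \<open>The first moment method, applied once to the sign vectors and once to the edge
  colours.\<close>

lemma pexp_less_imp_ex:
  fixes f :: "_ \<Rightarrow> real"
  assumes "pexp B w A f < c"
  shows "\<exists>x\<in>Pi\<^sub>E A (\<lambda>_. B). f x < c"
  using pexp_mono[of "\<lambda>_. c" f] pexp_const[of c] assms by (metis linorder_not_less)

lemma pexp_prod_subset:
  fixes g :: "'a \<Rightarrow> 'b \<Rightarrow> 'c::{real_algebra_1,comm_ring_1}"
  assumes "D \<subseteq> A"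
  shows "pexp B w A (\<lambda>x. \<Prod>a\<in>D. g a (x a)) = (\<Prod>a\<in>D. \<Sum>b\<in>B. w a b *\<^sub>R g a b)"
proof -
  \<comment> \<open>Coordinates outside \<open>D\<close> are padded with the factor 1, whose mean is
    1.\<close>
  have eq: "(\<Prod>a\<in>D. h a) = (\<Prod>a\<in>A. if a \<in> D then h a else 1)" for h :: "'a \<Rightarrow> 'c"
    using assms finite_A by (simp add: prod.inter_restrict[symmetric] Int_absorb1)
  have "pexp B w A (\<lambda>x. \<Prod>a\<in>D. g a (x a)) = pexp B w A (\<lambda>x. \<Prod>a\<in>A. (if a \<in> D then g a (x a) else 1))"
    by (simp only: eq)
  also have "\<dots> = (\<Prod>a\<in>A. \<Sum>b\<in>B. w a b *\<^sub>R (if a \<in> D then g a b else 1))"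
    by (rule pexp_prod[OF finite_A finite_B, where g = "\<lambda>a b. if a \<in> D then g a b else 1"])
  also have "\<dots> = (\<Prod>a\<in>A. if a \<in> D then \<Sum>b\<in>B. w a b *\<^sub>R g a b else 1)"
    using w_sum by (intro prod.cong) (auto simp flip: scaleR_sum_left)
  also have "\<dots> = (\<Prod>a\<in>D. \<Sum>b\<in>B. w a b *\<^sub>R g a b)"
    by (simp only: eq)
  finally show ?thesis .
qed

end

section \<open>Exponential moments under bounded differences\<close>

lemma exp_le_one_plus_sq:
  fixes x :: real
  assumes "\<bar>x\<bar> \<le> 1"
  shows "exp x \<le> 1 + x + x\<^sup>2"
proof (cases "x \<ge> 0")
  case True
  then show ?thesis using assms exp_bound[of x] by simp
next
  case False
  \<comment> \<open>For negative \<open>x\<close>, multiplying by \<open>1 - x\<close>, which is at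
    most \<open>exp (- x)\<close>, reduces the claim to \<open>1 \<le> 1 - x ^ 3\<close>.\<close>
  have "(1 + x + x\<^sup>2) * (1 - x) = 1 - x ^ 3"
    by (simp add: algebra_simps power2_eq_square power3_eq_cube)
  also have "\<dots> \<ge> 1"
    using False by (simp add: power_le_zero_eq)
  finally have "1 \<le> (1 + x + x\<^sup>2) * (1 - x)" .
  also have "\<dots> \<le> (1 + x + x\<^sup>2) * exp (- x)"
  proof (rule mult_left_mono)
    show "0 \<le> 1 + x + x\<^sup>2" using assms by (smt (verit) zero_le_power2)
  qed (use exp_ge_add_one_self[of "- x"] in simp)
  finally show ?thesis
    by (simp add: exp_minus field_simps)
qed

text \<open>Hoeffding's lemma with a crude constant: after centring at the mean the linear term
  averages to zero and the quadratic term is at most \<open>c\<^sup>2\<close>.\<close>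

lemma sum_exp_le:
  fixes h :: "'b \<Rightarrow> real" and c :: real
  assumes w: "\<And>b. b \<in> B \<Longrightarrow> 0 \<le> w b" "sum w B = 1" and c: "0 \<le> c" "c \<le> 1"
    and h: "\<And>b b'. b \<in> B \<Longrightarrow> b' \<in> B \<Longrightarrow> \<bar>h b - h b'\<bar> \<le> c"
  shows "(\<Sum>b\<in>B. w b * exp (h b)) \<le> exp ((\<Sum>b\<in>B. w b * h b) + c\<^sup>2)"
proof -
  define \<mu> where "\<mu> = (\<Sum>b\<in>B. w b * h b)"
  have dev: "\<bar>h b - \<mu>\<bar> \<le> c" if "b \<in> B" for b
  proof -
    have "h b - \<mu> = (\<Sum>b'\<in>B. w b' * (h b - h b'))"
      using w(2) by (simp add: \<mu>_def right_diff_distrib sum_subtractf flip: sum_distrib_right)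
    also have "\<bar>\<dots>\<bar> \<le> (\<Sum>b'\<in>B. w b' * c)"
      using w h that by (intro order.trans[OF sum_abs] sum_mono) (auto simp: abs_mult intro!: mult_left_mono)
    also have "\<dots> = c" using w(2) by (simp flip: sum_distrib_right)
    finally show ?thesis .
  qed
  have "(\<Sum>b\<in>B. w b * exp (h b)) = exp \<mu> * (\<Sum>b\<in>B. w b * exp (h b - \<mu>))"
    by (simp add: sum_distrib_left exp_diff field_simps)
  also have "(\<Sum>b\<in>B. w b * exp (h b - \<mu>)) \<le> (\<Sum>b\<in>B. w b * (1 + (h b - \<mu>) + c\<^sup>2))"
  proof (intro sum_mono mult_left_mono w(1))
    fix b assume b: "b \<in> B"
    have "exp (h b - \<mu>) \<le> 1 + (h b - \<mu>) + (h b - \<mu>)\<^sup>2"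
      using dev[OF b] c by (intro exp_le_one_plus_sq) simp
    also have "(h b - \<mu>)\<^sup>2 \<le> c\<^sup>2"
      using dev[OF b] c by (simp add: abs_le_square_iff[symmetric])
    finally show "exp (h b - \<mu>) \<le> 1 + (h b - \<mu>) + c\<^sup>2" by simp
  qed
  also have "\<dots> = 1 + c\<^sup>2"
    using w(2) by (simp add: algebra_simps sum.distrib sum_subtractf \<mu>_def flip: sum_distrib_left sum_distrib_right)
  also have "\<dots> \<le> exp (c\<^sup>2)"
    by (rule exp_ge_add_one_self)
  finally show ?thesis
    by (simp add: exp_add \<mu>_def)
qed

text \<open>The moment generating function form of McDiarmid's bounded differences inequality.\<close>

lemma pexp_exp_le:
  fixes f :: "('a \<Rightarrow> 'b) \<Rightarrow> real" and c :: real
  assumes "finite A" "finite B" "\<And>a b. b \<in> B \<Longrightarrow> 0 \<le> w a b" "\<And>a. (\<Sum>b\<in>B. w a b) = 1"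
    and c: "0 \<le> c" "c \<le> 1"
    and "\<And>x a b. x \<in> Pi\<^sub>E A (\<lambda>_. B) \<Longrightarrow> a \<in> A \<Longrightarrow> b \<in> B \<Longrightarrow> \<bar>f (x(a := b)) - f x\<bar> \<le> c"
  shows "pexp B w A (\<lambda>x. exp (f x)) \<le> exp (pexp B w A f + card A * c\<^sup>2)"
  using assms(1,7)
proof (induction A arbitrary: f rule: finite_induct)
  case empty
  then show ?case by (simp add: pexp_def)
next
  case (insert a A)
  note B = assms(2) and w = assms(3,4)
  interpret weights B w A
    using insert.hyps B w by unfold_locales auto
  \<comment> \<open>The conditional mean given the value \<open>b\<close> at \<open>a\<close>. It
    inherits the oscillation bound, so the one-variable estimate \<open>sum_exp_le\<close> applies
    to it.\<close>
  define h where "h b = pexp B w A (\<lambda>x. f (x(a := b)))" for b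
  have upd: "x(a := b) \<in> Pi\<^sub>E (insert a A) (\<lambda>_. B)" if "x \<in> Pi\<^sub>E A (\<lambda>_. B)" "b \<in> B" for x b
    using that by (auto simp: PiE_iff extensional_def)
  have *: "pexp B w A (\<lambda>x. exp (f (x(a := b)))) \<le> exp (h b + card A * c\<^sup>2)" if b: "b \<in> B" for b
    unfolding h_def
  proof (rule insert.IH)
    fix x a' b' assume x: "x \<in> Pi\<^sub>E A (\<lambda>_. B)" "a' \<in> A" "b' \<in> B"
    then have "x(a' := b', a := b) = x(a := b, a' := b')"
      using insert.hyps by (intro fun_upd_twist) auto
    with insert.prems[OF upd[OF x(1) b], of a' b'] x
    show "\<bar>f (x(a' := b', a := b)) - f (x(a := b))\<bar> \<le> c"
      by (metis insertI2)
  qed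
  have "pexp B w (insert a A) (\<lambda>x. exp (f x)) \<le> (\<Sum>b\<in>B. w a b * exp (h b + card A * c\<^sup>2))"
    using insert.hyps B w * by (subst pexp_insert) (auto intro!: sum_mono mult_left_mono)
  also have "\<dots> = (\<Sum>b\<in>B. w a b * exp (h b)) * exp (card A * c\<^sup>2)"
    by (simp add: exp_add sum_distrib_right mult.assoc)
  also have "\<dots> \<le> exp ((\<Sum>b\<in>B. w a b * h b) + c\<^sup>2) * exp (card A * c\<^sup>2)"
  proof (intro mult_right_mono sum_exp_le w c)
    fix b b' assume b: "b \<in> B" "b' \<in> B"
    have "h b - h b' = pexp B w A (\<lambda>x. f (x(a := b)) - f (x(a := b')))"
      by (simp add: h_def pexp_diff)
    also have "norm \<dots> \<le> c"
    proof (rule norm_pexp_le)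
      fix x assume "x \<in> Pi\<^sub>E A (\<lambda>_. B)"
      from insert.prems[OF upd[OF this b(2)], of a b] b
      show "norm (f (x(a := b)) - f (x(a := b'))) \<le> c"
        by (metis fun_upd_upd insertI1 real_norm_def)
    qed
    finally show "\<bar>h b - h b'\<bar> \<le> c" by simp
  qed auto
  also have "(\<Sum>b\<in>B. w a b * h b) = pexp B w (insert a A) f"
    using insert.hyps B by (subst pexp_insert) (auto simp: h_def)
  finally show ?case
    using insert.hyps by (simp add: exp_add[symmetric] algebra_simps)
qed

section \<open>Rademacher sums\<close>

definition rad :: "'a set \<Rightarrow> (('a \<Rightarrow> real) \<Rightarrow> 'c::real_vector) \<Rightarrow> 'c" where
  "rad V f = pexp {-1, 1} (\<lambda>_ _. 1/2) V f"

text \<open>The Walsh character of the set \<open>e\<close>.\<close>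

definition chi :: "'a set \<Rightarrow> ('a \<Rightarrow> real) \<Rightarrow> real" where
  "chi e x = (\<Prod>i\<in>e. x i)"

definition chi_sum :: "'a set \<Rightarrow> ('a \<Rightarrow> real) \<Rightarrow> real" where
  "chi_sum K x = (\<Sum>e\<in>nsets K 2. chi e x)"

lemma weights_rad: "finite V \<Longrightarrow> weights {-1, 1::real} (\<lambda>_ _. 1/2) V"
  by unfold_locales auto

lemma rad_insert:
  assumes "finite V" "v \<notin> V"
  shows "rad (insert v V) f = rad V (\<lambda>x. (1/2) *\<^sub>R (f (x(v := 1)) + f (x(v := -1))))"
proof -
  have lin: "rad V (\<lambda>x. (1/2) *\<^sub>R g x) = (1/2) *\<^sub>R rad V g" for g :: "_ \<Rightarrow> 'b"
    unfolding rad_def by (rule pexp_linear) (auto intro!: linearI simp: scaleR_add_right)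
  show ?thesis
    using assms unfolding lin
    by (simp add: rad_def pexp_insert pexp_add scaleR_add_right add.commute)
qed

lemma tanh_real_le_self:
  fixes x :: real
  assumes "0 \<le> x"
  shows "tanh x \<le> x"
proof -
  have "0 - tanh 0 \<le> x - tanh x"
  proof (rule DERIV_nonneg_imp_nondecreasing[OF assms])
    fix y :: real
    have "((\<lambda>y. y - tanh y) has_real_derivative 1 - (1 - tanh y ^ 2)) (at y)"
      by (auto intro!: derivative_eq_intros simp: cosh_real_nonzero)
    then show "\<exists>d. ((\<lambda>y. y - tanh y) has_real_derivative d) (at y) \<and> 0 \<le> d"
      by (intro exI[of _ "tanh y ^ 2"]) simp
  qed
  then show ?thesis by simp
qed

text \<open>The difference of the logarithms has derivative \<open>y - tanh y\<close>, which is
  nonnegative for nonnegative \<open>y\<close>; evenness covers the negative half-line.\<close>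

lemma cosh_real_le_exp_square: "cosh x \<le> exp (x\<^sup>2 / 2)" for x :: real
proof -
  have "cosh x \<le> exp (x\<^sup>2 / 2)" if "0 \<le> x" for x :: real
  proof -
    have "0\<^sup>2 / 2 - ln (cosh 0) \<le> x\<^sup>2 / 2 - ln (cosh x)"
    proof (rule DERIV_nonneg_imp_nondecreasing[OF that])
      fix y :: real assume "0 \<le> y"
      have "((\<lambda>y. y\<^sup>2 / 2 - ln (cosh y)) has_real_derivative y - tanh y) (at y)"
        by (auto intro!: derivative_eq_intros simp: tanh_def cosh_real_pos)
      then show "\<exists>d. ((\<lambda>y. y\<^sup>2 / 2 - ln (cosh y)) has_real_derivative d) (at y) \<and> 0 \<le> d"
        using tanh_real_le_self[OF \<open>0 \<le> y\<close>] by (intro exI[of _ "y - tanh y"]) simp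
    qed
    then have "ln (cosh x) \<le> x\<^sup>2 / 2" by simp
    then show ?thesis by (metis cosh_real_pos exp_le_cancel_iff exp_ln)
  qed
  from this[of "\<bar>x\<bar>"] show ?thesis by simp
qed

lemma nsets_empty_2 [simp]: "nsets {} 2 = {}"
  by (simp add: nsets_2_eq)

text \<open>The bound is the value for a standard Gaussian sum; it is stable under removing one summand and
  replacing \<open>a\<close> by \<open>a - 1\<close>.\<close>

lemma rad_exp_square:
  fixes a :: real
  assumes "finite V" "K \<subseteq> V" "card K < a"
  shows "rad V (\<lambda>x. exp ((\<Sum>i\<in>K. x i)\<^sup>2 / (2 * a))) \<le> sqrt (a / (a - card K))"
  using assms
proof (induction V arbitrary: K a rule: finite_induct)
  case empty
  then show ?case by (simp add: rad_def pexp_def)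
next
  case (insert v V)
  interpret weights "{-1, 1::real}" "\<lambda>_ _. 1/2" V
    using insert.hyps by (intro weights_rad)
  show ?case
  proof (cases "v \<in> K")
    case False
    then have "(\<Sum>i\<in>K. (x(v := b)) i) = (\<Sum>i\<in>K. x i)" for x :: "'a \<Rightarrow> real" and b
      by (intro sum.cong) auto
    then show ?thesis
      using insert False by (simp add: rad_insert subset_insert_iff)
  next
    case True
    define K' where "K' = K - {v}"
    have K': "K' \<subseteq> V" "finite K'" "v \<notin> K'" "K = insert v K'"
      using insert.prems insert.hyps True by (auto simp: K'_def intro: finite_subset)
    have cK: "card K = card K' + 1" using K' by simp
    then have a: "a - 1 > card K'" "a > 1" using insert.prems by auto
    have step: "(1/2) *\<^sub>R (exp ((S + 1)\<^sup>2 / (2 * a)) + exp ((S - 1)\<^sup>2 / (2 * a)))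
        \<le> exp (1 / (2 * a)) * exp (S\<^sup>2 / (2 * (a - 1)))" for S :: real
    proof -
      have "(1/2) *\<^sub>R (exp ((S + 1)\<^sup>2 / (2 * a)) + exp ((S - 1)\<^sup>2 / (2 * a)))
          = exp (1 / (2 * a)) * exp (S\<^sup>2 / (2 * a)) * cosh (S / a)"
        using a by (simp add: cosh_def power2_eq_square field_simps flip: exp_add)
      also have "\<dots> \<le> exp (1 / (2 * a)) * exp (S\<^sup>2 / (2 * a)) * exp ((S / a)\<^sup>2 / 2)"
        by (intro mult_left_mono cosh_real_le_exp_square) simp
      also have "\<dots> = exp (1 / (2 * a)) * exp (S\<^sup>2 * ((a + 1) / a\<^sup>2) / 2)"
        using a by (simp add: field_simps power2_eq_square flip: exp_add)
      \<comment> \<open>The Gaussian shape returns with \<open>a - 1\<close> in place of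
        \<open>a\<close>; the price is the factor \<open>exp (1 / (2 * a))\<close>.\<close>
      also have "\<dots> \<le> exp (1 / (2 * a)) * exp (S\<^sup>2 * (1 / (a - 1)) / 2)"
      proof -
        have "(a + 1) / a\<^sup>2 \<le> 1 / (a - 1)"
          using a by (simp add: field_simps power2_eq_square)
        then have "S\<^sup>2 * ((a + 1) / a\<^sup>2) \<le> S\<^sup>2 * (1 / (a - 1))"
          by (rule mult_left_mono) simp
        then have "S\<^sup>2 * ((a + 1) / a\<^sup>2) / 2 \<le> S\<^sup>2 * (1 / (a - 1)) / 2"
          by (rule divide_right_mono) simp
        then show ?thesis
          by (intro mult_left_mono iffD2[OF exp_le_cancel_iff]) (assumption | simp)+
      qed
      also have "S\<^sup>2 * (1 / (a - 1)) / 2 = S\<^sup>2 / (2 * (a - 1))"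
        by simp
      finally show ?thesis .
    qed
    have upd: "(\<Sum>i\<in>K. (x(v := b)) i) = (\<Sum>i\<in>K'. x i) + b" for x :: "'a \<Rightarrow> real" and b
    proof -
      have "(\<Sum>i\<in>K'. (x(v := b)) i) = (\<Sum>i\<in>K'. x i)" using K' by (intro sum.cong) auto
      then show ?thesis using K' by simp
    qed
    have "rad (insert v V) (\<lambda>x. exp ((\<Sum>i\<in>K. x i)\<^sup>2 / (2 * a)))
        \<le> rad V (\<lambda>x. exp (1 / (2 * a)) * exp ((\<Sum>i\<in>K'. x i)\<^sup>2 / (2 * (a - 1))))"
      unfolding rad_insert[OF insert.hyps] upd unfolding rad_def
      by (intro pexp_mono) (use step in simp)
    also have "\<dots> = exp (1 / (2 * a)) * rad V (\<lambda>x. exp ((\<Sum>i\<in>K'. x i)\<^sup>2 / (2 * (a - 1))))"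
      unfolding rad_def by (rule pexp_mult_left)
    also have "\<dots> \<le> exp (1 / (2 * a)) * sqrt ((a - 1) / (a - 1 - card K'))"
      using insert.IH[OF K'(1) a(1)] by simp
    also have "exp (1 / (2 * a)) = sqrt (exp (1 / a))"
      by (simp add: real_sqrt_unique[symmetric] exp_double[symmetric])
    also have "sqrt (exp (1 / a)) * sqrt ((a - 1) / (a - 1 - card K'))
        = sqrt (exp (1 / a) * (a - 1) / (a - card K))"
      using cK by (simp add: real_sqrt_mult[symmetric] algebra_simps)
    \<comment> \<open>The denominators for \<open>K'\<close> and \<open>K\<close> agree, and the
      growth of the numerator from \<open>a - 1\<close> to \<open>a\<close> pays for the factor
      \<open>exp (1 / a)\<close>.\<close>
    also have "exp (1 / a) * (a - 1) \<le> a"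
    proof -
      have "1 - 1 / a \<le> exp (- (1 / a))" using exp_ge_add_one_self[of "- (1/a)"] by simp
      then show ?thesis using a by (simp add: exp_minus field_simps)
    qed
    finally show ?thesis using insert.prems by (simp add: divide_right_mono)
  qed
qed

section \<open>Moments of the sum of all edge characters of a vertex set\<close>

lemma nsets_insert_2:
  assumes "v \<notin> K"
  shows "nsets (insert v K) 2 = nsets K 2 \<union> (\<lambda>u. {v, u}) ` K"
  using assms by (auto simp: nsets_2_eq)

lemma chi_sum_insert:
  assumes "finite K" "v \<notin> K"
  shows "chi_sum (insert v K) x = chi_sum K x + x v * (\<Sum>i\<in>K. x i)"
proof -
  have "inj_on (\<lambda>u. {v, u}) K"
    by (auto simp: inj_on_def doubleton_eq_iff)
  moreover have "nsets K 2 \<inter> (\<lambda>u. {v, u}) ` K = {}"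
    using assms by (auto simp: nsets_def)
  moreover have "(\<Sum>u\<in>K. chi {v, u} x) = x v * (\<Sum>i\<in>K. x i)"
    unfolding sum_distrib_left using assms by (intro sum.cong refl) (subst chi_def, subst prod.insert, auto)
  ultimately show ?thesis
    using assms unfolding chi_sum_def nsets_insert_2[OF assms(2)]
    by (subst sum.union_disjoint) (auto simp: sum.reindex finite_imp_finite_nsets)
qed

lemma chi_sum_fun_upd:
  assumes "finite K" "v \<notin> K"
  shows "chi_sum K (x(v := b)) = chi_sum K x"
    "chi_sum (insert v K) (x(v := b)) = chi_sum K x + b * (\<Sum>i\<in>K. x i)"
proof -
  have "chi e (x(v := b)) = chi e x" if "e \<in> nsets K 2" for e
    using that assms unfolding chi_def by (intro prod.cong) (auto simp: nsets_def)
  then show *: "chi_sum K (x(v := b)) = chi_sum K x"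
    unfolding chi_sum_def by (intro sum.cong) auto
  have "(\<Sum>i\<in>K. (x(v := b)) i) = (\<Sum>i\<in>K. x i)"
    using assms by (intro sum.cong) auto
  with * show "chi_sum (insert v K) (x(v := b)) = chi_sum K x + b * (\<Sum>i\<in>K. x i)"
    using assms by (simp add: chi_sum_insert)
qed

text \<open>Signs square to one. The identity transfers exponential bounds for squares of linear
  sums to \<open>chi_sum\<close>, and it closes the moment recursion below.\<close>

lemma sum_square_eq_chi_sum:
  assumes "finite K" "\<And>i. i \<in> K \<Longrightarrow> x i \<in> {-1, 1}"
  shows "(\<Sum>i\<in>K. x i)\<^sup>2 = card K + 2 * chi_sum K x"
  using assms
proof (induction K rule: finite_induct)
  case empty
  then show ?case by (simp add: chi_sum_def)
next
  case (insert v K)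
  have "x v * x v = 1" using insert.prems[of v] by auto
  then show ?case
    using insert by (simp add: chi_sum_insert power2_sum) (simp add: power2_eq_square)
qed

text \<open>Removing a vertex \<open>v\<close> writes \<open>chi_sum K\<close> as
  \<open>t + x v * s\<close> with \<open>s\<close> linear. Averaging over the sign of
  \<open>v\<close> leaves even powers of \<open>s\<close>, and
  \<open>s\<^sup>2 = card K' + 2 * t\<close> expresses these through \<open>t\<close>. The third
  moment is the number of ordered triples of edges that form a triangle.\<close>

lemma rad_chi_sum_powers:
  assumes "finite V" "K \<subseteq> V"
  shows "rad V (chi_sum K) = 0"
    and "rad V (\<lambda>x. chi_sum K x ^ 2) = real (card K) * (real (card K) - 1) / 2"
    and "rad V (\<lambda>x. chi_sum K x ^ 3) = real (card K) * (real (card K) - 1) * (real (card K) - 2)"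
proof -
  have "rad V (chi_sum K) = 0 \<and> rad V (\<lambda>x. chi_sum K x ^ 2) = real (card K) * (real (card K) - 1) / 2
    \<and> rad V (\<lambda>x. chi_sum K x ^ 3) = real (card K) * (real (card K) - 1) * (real (card K) - 2)"
    using assms
  proof (induction V arbitrary: K rule: finite_induct)
    case empty
    then show ?case by (simp add: rad_def pexp_def chi_sum_def)
  next
    case (insert v V)
    interpret weights "{-1, 1::real}" "\<lambda>_ _. 1/2" V
      using insert.hyps by (intro weights_rad)
    show ?case
    proof (cases "v \<in> K")
      case False
      have "finite K" using insert finite_subset by blast
      then show ?thesis
        using insert False by (simp add: rad_insert chi_sum_fun_upd subset_insert_iff)
    next
      case True
      define K' where "K' = K - {v}"
      have K': "K' \<subseteq> V" "finite K'" "v \<notin> K'" "K = insert v K'"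
        using insert.prems insert.hyps True by (auto simp: K'_def intro: finite_subset)
      have cK: "real (card K) = card K' + 1" using K' by simp
      note IH = insert.IH[OF K'(1), unfolded rad_def]
      have S: "(\<Sum>i\<in>K'. x i)\<^sup>2 = card K' + 2 * chi_sum K' x" if "x \<in> Pi\<^sub>E V (\<lambda>_. {-1, 1})" for x
        using that K' by (intro sum_square_eq_chi_sum) (auto simp: PiE_iff)
      note upd = chi_sum_fun_upd(2)[OF K'(2,3), folded K'(4)]
      have 1: "rad (insert v V) (chi_sum K) = rad V (chi_sum K')"
        by (simp add: rad_insert insert.hyps upd)
      have "rad (insert v V) (\<lambda>x. chi_sum K x ^ 2)
          = rad V (\<lambda>x. chi_sum K' x ^ 2 + (2 * chi_sum K' x + card K'))"
        unfolding rad_insert[OF insert.hyps] upd unfolding rad_def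
        by (intro pexp_cong) (simp add: power2_eq_square algebra_simps S[unfolded power2_eq_square])
      then have 2: "rad (insert v V) (\<lambda>x. chi_sum K x ^ 2) = rad V (\<lambda>x. chi_sum K' x ^ 2) + card K'"
        using IH by (simp add: rad_def pexp_add pexp_const pexp_mult_left)
      have "rad (insert v V) (\<lambda>x. chi_sum K x ^ 3)
          = rad V (\<lambda>x. chi_sum K' x ^ 3 + (6 * chi_sum K' x ^ 2 + (3 * card K') * chi_sum K' x))"
        unfolding rad_insert[OF insert.hyps] upd unfolding rad_def
      proof (intro pexp_cong)
        fix x :: "'a \<Rightarrow> real" assume x: "x \<in> Pi\<^sub>E V (\<lambda>_. {-1, 1})"
        define s t where "s = (\<Sum>i\<in>K'. x i)" and "t = chi_sum K' x"
        have "(1/2) *\<^sub>R ((t + 1 * s) ^ 3 + (t + (-1) * s) ^ 3) = t ^ 3 + 3 * t * s\<^sup>2"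
          by (simp add: power2_eq_square power3_eq_cube algebra_simps)
        also have "s\<^sup>2 = card K' + 2 * t" using S[OF x] by (simp add: s_def t_def)
        finally show "(1/2) *\<^sub>R ((t + 1 * s) ^ 3 + (t + (-1) * s) ^ 3) = t ^ 3 + (6 * t\<^sup>2 + (3 * card K') * t)"
          by (simp add: power2_eq_square algebra_simps)
      qed
      then have 3: "rad (insert v V) (\<lambda>x. chi_sum K x ^ 3) = rad V (\<lambda>x. chi_sum K' x ^ 3) + 6 * rad V (\<lambda>x. chi_sum K' x ^ 2)"
        using IH by (simp add: rad_def pexp_add pexp_mult_left)
      show ?thesis unfolding 1 2 3
        using insert.IH[OF K'(1)] by (simp add: cK field_simps)
    qed
  qed
  then show "rad V (chi_sum K) = 0"
    and "rad V (\<lambda>x. chi_sum K x ^ 2) = real (card K) * (real (card K) - 1) / 2"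
    and "rad V (\<lambda>x. chi_sum K x ^ 3) = real (card K) * (real (card K) - 1) * (real (card K) - 2)"
    by auto
qed

section \<open>Exponential moments of complex combinations of edge characters\<close>

lemma power_sum_PiE:
  fixes a :: "'a \<Rightarrow> 'c::comm_semiring_1"
  assumes "finite F"
  shows "(\<Sum>e\<in>F. a e) ^ j = (\<Sum>\<phi>\<in>Pi\<^sub>E {..<j} (\<lambda>_. F). \<Prod>t<j. a (\<phi> t))"
  using prod_sum_PiE[of "{..<j}" "\<lambda>_. F" "\<lambda>_. a"] assms by simp

text \<open>The mean factorises over the vertices, and each factor is the average of 1 and a number
  of absolute value 1.\<close>

lemma rad_prod_chi_nonneg:
  assumes "finite V" "\<And>t. t \<in> T \<Longrightarrow> e t \<subseteq> V" "finite T"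
  shows "0 \<le> rad V (\<lambda>x. \<Prod>t\<in>T. chi (e t) x)"
proof -
  have "(\<Prod>t\<in>T. chi (e t) x) = (\<Prod>i\<in>V. \<Prod>t\<in>T. if i \<in> e t then x i else 1)" for x
  proof -
    have "(\<Prod>t\<in>T. chi (e t) x) = (\<Prod>t\<in>T. \<Prod>i\<in>V. if i \<in> e t then x i else 1)"
    proof (rule prod.cong[OF refl])
      fix t assume "t \<in> T"
      with assms show "chi (e t) x = (\<Prod>i\<in>V. if i \<in> e t then x i else 1)"
        by (simp add: chi_def prod.inter_restrict[symmetric] Int_absorb1)
    qed
    then show ?thesis by (simp add: prod.swap[of _ T])
  qed
  then have "rad V (\<lambda>x. \<Prod>t\<in>T. chi (e t) x)
      = (\<Prod>i\<in>V. \<Sum>b\<in>{-1, 1}. (1/2) *\<^sub>R (\<Prod>t\<in>T. if i \<in> e t then b else 1))"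
    unfolding rad_def using assms pexp_prod[of V "{-1, 1}" "\<lambda>_ _. 1/2" "\<lambda>i b. \<Prod>t\<in>T. if i \<in> e t then b else (1::real)"]
    by simp
  also have "\<dots> \<ge> 0"
  proof (intro prod_nonneg)
    fix i
    have "\<bar>\<Prod>t\<in>T. if i \<in> e t then - 1 else (1::real)\<bar> = 1"
      unfolding abs_prod by (intro prod.neutral) auto
    then show "0 \<le> (\<Sum>b\<in>{-1, 1}. (1/2) *\<^sub>R (\<Prod>t\<in>T. if i \<in> e t then b else (1::real)))"
      by simp
  qed
  finally show ?thesis .
qed

text \<open>Products of characters have nonnegative expectation, so complex coefficients can be replaced by a
  bound for their norms.\<close>

lemma norm_rad_power_le:
  fixes g :: "'a set \<Rightarrow> complex"
  assumes "finite V" "finite F" "\<And>e. e \<in> F \<Longrightarrow> e \<subseteq> V" "\<And>e. e \<in> F \<Longrightarrow> norm (g e) \<le> R" "0 \<le> R"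
  shows "norm (rad V (\<lambda>x. (\<Sum>e\<in>F. g e * of_real (chi e x)) ^ j)) \<le> R ^ j * rad V (\<lambda>x. (\<Sum>e\<in>F. chi e x) ^ j)"
proof -
  let ?P = "Pi\<^sub>E {..<j} (\<lambda>_. F)"
  let ?r = "\<lambda>\<phi>. rad V (\<lambda>x. \<Prod>t<j. chi (\<phi> t) x)"
  have "rad V (\<lambda>x. (\<Sum>e\<in>F. g e * of_real (chi e x)) ^ j)
      = (\<Sum>\<phi>\<in>?P. (\<Prod>t<j. g (\<phi> t)) * of_real (?r \<phi>))"
    unfolding power_sum_PiE[OF assms(2)] rad_def
    by (simp add: prod.distrib pexp_sum pexp_mult_left flip: of_real_prod pexp_of_real)
  also have "norm \<dots> \<le> (\<Sum>\<phi>\<in>?P. R ^ j * ?r \<phi>)"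
  proof (intro order.trans[OF norm_sum] sum_mono)
    fix \<phi> assume \<phi>: "\<phi> \<in> ?P"
    have "0 \<le> ?r \<phi>"
      using \<phi> assms by (intro rad_prod_chi_nonneg) auto
    moreover have "norm (\<Prod>t<j. g (\<phi> t)) \<le> R ^ j"
      using \<phi> assms prod_mono[of "{..<j}" "\<lambda>t. norm (g (\<phi> t))" "\<lambda>_. R"]
      by (auto simp: prod_norm)
    ultimately show "norm ((\<Prod>t<j. g (\<phi> t)) * of_real (?r \<phi>)) \<le> R ^ j * ?r \<phi>"
      by (simp add: norm_mult mult_right_mono)
  qed
  also have "\<dots> = R ^ j * rad V (\<lambda>x. (\<Sum>e\<in>F. chi e x) ^ j)"
    unfolding power_sum_PiE[OF assms(2)] rad_def by (simp add: pexp_sum sum_distrib_left)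
  finally show ?thesis .
qed

text \<open>Twice \<open>chi_sum K\<close> is the square of the linear sum minus
  \<open>card K\<close>, so its absolute value is controlled by that square, and
  \<open>rad_exp_square\<close> applies with \<open>a = 2 * card K\<close>.\<close>

lemma rad_exp_abs_chi_sum:
  assumes "finite V" "K \<subseteq> V" "K \<noteq> {}"
  shows "rad V (\<lambda>x. exp (\<bar>chi_sum K x\<bar> / (2 * card K))) \<le> 2"
proof -
  have K: "finite K" "0 < card K" using assms finite_subset by (auto simp: card_gt_0_iff)
  let ?m = "real (card K)"
  have "rad V (\<lambda>x. exp (\<bar>chi_sum K x\<bar> / (2 * ?m)))
      \<le> rad V (\<lambda>x. exp (1/4) * exp ((\<Sum>i\<in>K. x i)\<^sup>2 / (2 * (2 * ?m))))"
    unfolding rad_def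
  proof (intro weights.pexp_mono weights_rad assms)
    fix x :: "'a \<Rightarrow> real" assume "x \<in> Pi\<^sub>E V (\<lambda>_. {-1, 1})"
    then have S: "(\<Sum>i\<in>K. x i)\<^sup>2 = ?m + 2 * chi_sum K x"
      using assms(2) by (intro sum_square_eq_chi_sum K) (auto simp: PiE_iff)
    have "0 \<le> (\<Sum>i\<in>K. x i)\<^sup>2" by simp
    then have "\<bar>chi_sum K x\<bar> \<le> (?m + (\<Sum>i\<in>K. x i)\<^sup>2) / 2"
      unfolding S by (auto simp: abs_le_iff)
    then have "\<bar>chi_sum K x\<bar> / (2 * ?m) \<le> ((?m + (\<Sum>i\<in>K. x i)\<^sup>2) / 2) / (2 * ?m)"
      by (rule divide_right_mono) simp
    also have "\<dots> = 1/4 + (\<Sum>i\<in>K. x i)\<^sup>2 / (2 * (2 * ?m))"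
    proof -
      have "?m \<noteq> 0" using K(2) by linarith
      then show ?thesis by (simp add: divide_simps)
    qed
    finally show "exp (\<bar>chi_sum K x\<bar> / (2 * ?m)) \<le> exp (1/4) * exp ((\<Sum>i\<in>K. x i)\<^sup>2 / (2 * (2 * ?m)))"
      by (simp flip: exp_add)
  qed
  also have "\<dots> = exp (1/4) * rad V (\<lambda>x. exp ((\<Sum>i\<in>K. x i)\<^sup>2 / (2 * (2 * ?m))))"
    unfolding rad_def by (rule pexp_mult_left)
  also have "\<dots> \<le> exp (1/4) * sqrt ((2 * ?m) / (2 * ?m - ?m))"
    using assms K by (intro mult_left_mono rad_exp_square) auto
  also have "(2 * ?m) / (2 * ?m - ?m) = 2"
    using K(2) by (simp del: card_gt_0_iff card_0_eq)
  \<comment> \<open>\<open>exp_bound\<close> gives \<open>1 + 1/4 + 1/16 = 21/16\<close>, and the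
    product \<open>63/32\<close> is below 2.\<close>
  also have "exp (1/4) * sqrt 2 \<le> (21/16) * (3/2 :: real)"
    using exp_bound[of "1/4"]
    by (intro mult_mono real_le_lsqrt) (auto simp: power2_eq_square)
  finally show ?thesis by simp
qed

text \<open>The squared norm is exactly \<open>1 + 2 * Re z + (norm z)\<^sup>2\<close>, so at first
  order only the real part counts.\<close>

lemma norm_one_plus_le: "norm (1 + z) \<le> exp (Re z + (norm z)\<^sup>2 / 2)" for z :: complex
proof -
  have "(norm (1 + z))\<^sup>2 = 1 + (2 * Re z + (norm z)\<^sup>2)"
    unfolding cmod_power2 by (simp add: power2_eq_square algebra_simps)
  also have "\<dots> \<le> exp (2 * Re z + (norm z)\<^sup>2)"
    by (rule exp_ge_add_one_self)
  also have "\<dots> = (exp (Re z + (norm z)\<^sup>2 / 2))\<^sup>2"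
    by (simp flip: exp_double add: algebra_simps)
  finally show ?thesis by (rule power2_le_imp_le) simp
qed

lemma exp_tail_sums:
  fixes z :: "'a::{real_normed_field,banach}"
  shows "(\<lambda>j. z ^ (j + 4) /\<^sub>R fact (j + 4)) sums (exp z - (1 + z + z ^ 2 /\<^sub>R 2 + z ^ 3 /\<^sub>R 6))"
  using sums_split_initial_segment[OF exp_converges[of z], of 4]
  by (simp add: eval_nat_numeral scaleR_conv_of_real)

text \<open>The pointwise bound on \<open>W\<close> is of order \<open>r * (card K)\<^sup>2\<close>,
  which is too large. Instead the moments of \<open>W\<close> are dominated by those of
  \<open>chi_sum K\<close>, which has exponential moments at scale \<open>card K\<close>. Extracting
  four powers of \<open>2 * card K * r\<close> from the Taylor tail leaves a bounded exponential
  moment.\<close>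

lemma rad_exp_remainder:
  fixes g :: "'a set \<Rightarrow> complex" and r :: real
  assumes V: "finite V" "K \<subseteq> V" "K \<noteq> {}"
    and g: "\<And>e. e \<in> nsets K 2 \<Longrightarrow> norm (g e) \<le> r" "0 \<le> r"
    and q: "2 * real (card K) * r \<le> 1"
  defines "W \<equiv> \<lambda>x. \<Sum>e\<in>nsets K 2. g e * of_real (chi e x)"
  shows "norm (rad V (\<lambda>x. exp (W x) - (1 + W x + W x ^ 2 /\<^sub>R 2 + W x ^ 3 /\<^sub>R 6))) \<le> 2 * (2 * real (card K) * r) ^ 4"
proof -
  define m where "m = real (card K)"
  have K: "finite K" using V finite_subset by blast
  have m: "0 < m" using V K by (auto simp: m_def card_gt_0_iff)
  define y where "y x = \<bar>chi_sum K x\<bar> / (2 * m)" for x :: "'a \<Rightarrow> real"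
  define b where "b j = rad V (\<lambda>x. (2 * m * r) ^ 4 * (y x ^ (j + 4) /\<^sub>R fact (j + 4)))" for j
  define t where "t = rad V (\<lambda>x. (2 * m * r) ^ 4 * (exp (y x) - (1 + y x + y x ^ 2 /\<^sub>R 2 + y x ^ 3 /\<^sub>R 6)))"
  interpret weights "{-1, 1::real}" "\<lambda>_ _. 1/2" V
    using V by (intro weights_rad)
  have b: "b sums t"
    unfolding b_def t_def rad_def by (intro pexp_sums sums_mult exp_tail_sums)
  have S: "(\<lambda>j. rad V (\<lambda>x. W x ^ (j + 4) /\<^sub>R fact (j + 4))) sums
      rad V (\<lambda>x. exp (W x) - (1 + W x + W x ^ 2 /\<^sub>R 2 + W x ^ 3 /\<^sub>R 6))"
    unfolding rad_def by (intro pexp_sums exp_tail_sums)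
  have N: "norm (rad V (\<lambda>x. W x ^ (j + 4) /\<^sub>R fact (j + 4))) \<le> b j" for j
  proof -
    have "rad V (\<lambda>x. W x ^ (j + 4) /\<^sub>R fact (j + 4)) = rad V (\<lambda>x. W x ^ (j + 4)) /\<^sub>R fact (j + 4)"
      unfolding rad_def by (rule pexp_linear) (auto intro!: linearI simp: scaleR_add_right)
    also have "norm \<dots> = norm (rad V (\<lambda>x. W x ^ (j + 4))) / fact (j + 4)"
      by (simp add: field_simps)
    also have "\<dots> \<le> r ^ (j + 4) * rad V (\<lambda>x. chi_sum K x ^ (j + 4)) / fact (j + 4)"
      unfolding W_def chi_sum_def using V K g
      by (intro divide_right_mono norm_rad_power_le) (auto simp: nsets_def finite_imp_finite_nsets)
    also have "\<dots> = rad V (\<lambda>x. r ^ (j + 4) / fact (j + 4) * chi_sum K x ^ (j + 4))"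
      unfolding rad_def pexp_mult_left by simp
    also have "\<dots> \<le> b j"
      unfolding b_def rad_def
    proof (rule pexp_mono)
      fix x :: "'a \<Rightarrow> real"
      have y: "0 \<le> y x" "\<bar>chi_sum K x\<bar> = 2 * m * y x" using m by (auto simp: y_def)
      have "chi_sum K x ^ (j + 4) \<le> (2 * m * y x) ^ (j + 4)"
        unfolding y(2)[symmetric] by (metis abs_ge_self power_abs)
      then have "r ^ (j + 4) / fact (j + 4) * chi_sum K x ^ (j + 4) \<le> r ^ (j + 4) / fact (j + 4) * (2 * m * y x) ^ (j + 4)"
        using g(2) by (intro mult_left_mono) auto
      also have "\<dots> = (2 * m * r) ^ 4 * ((2 * m * r) ^ j * (y x ^ (j + 4) / fact (j + 4)))"
        by (simp add: power_mult_distrib power_add field_simps)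
      \<comment> \<open>Powers of \<open>2 * m * r\<close> beyond the fourth are discarded, since
        this number is at most 1.\<close>
      also have "\<dots> \<le> (2 * m * r) ^ 4 * (1 * (y x ^ (j + 4) / fact (j + 4)))"
        using q m g(2) y by (intro mult_left_mono mult_right_mono power_le_one) (auto simp: m_def)
      finally show "r ^ (j + 4) / fact (j + 4) * chi_sum K x ^ (j + 4) \<le> (2 * m * r) ^ 4 * (y x ^ (j + 4) /\<^sub>R fact (j + 4))"
        by (simp add: field_simps)
    qed
    finally show ?thesis .
  qed
  have "norm (rad V (\<lambda>x. exp (W x) - (1 + W x + W x ^ 2 /\<^sub>R 2 + W x ^ 3 /\<^sub>R 6))) \<le> t"
    unfolding sums_unique[OF S] sums_unique[OF b] by (rule norm_suminf_le[OF N sums_summable[OF b]])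
  also have "t \<le> rad V (\<lambda>x. (2 * m * r) ^ 4 * exp (y x))"
    unfolding t_def rad_def
  proof (intro pexp_mono mult_left_mono)
    fix x :: "'a \<Rightarrow> real"
    have "0 \<le> y x" using m by (simp add: y_def)
    then show "exp (y x) - (1 + y x + y x ^ 2 /\<^sub>R 2 + y x ^ 3 /\<^sub>R 6) \<le> exp (y x)"
      using zero_le_power[OF \<open>0 \<le> y x\<close>, of 2] zero_le_power[OF \<open>0 \<le> y x\<close>, of 3]
      unfolding real_scaleR_def inverse_eq_divide by linarith
  qed simp
  also have "\<dots> = (2 * m * r) ^ 4 * rad V (\<lambda>x. exp (y x))"
    unfolding rad_def by (rule pexp_mult_left)
  also have "\<dots> \<le> (2 * m * r) ^ 4 * 2"
    using rad_exp_abs_chi_sum[OF V] by (intro mult_left_mono) (auto simp: y_def m_def)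
  finally show ?thesis by (simp add: m_def mult.commute)
qed

text \<open>The first moment of \<open>W\<close> vanishes. With \<open>q = 2 * card K * r\<close>,
  the Taylor remainder costs at most \<open>2 * q ^ 4\<close> and the square in
  \<open>norm_one_plus_le\<close> at most \<open>9/2 * q ^ 4\<close>, together below
  \<open>7 * q ^ 4\<close>.\<close>

lemma norm_rad_exp_le:
  fixes g :: "'a set \<Rightarrow> complex" and r :: real
  assumes V: "finite V" "K \<subseteq> V" "K \<noteq> {}"
    and g: "\<And>e. e \<in> nsets K 2 \<Longrightarrow> norm (g e) \<le> r" "0 \<le> r"
    and q: "2 * real (card K) * r \<le> 1"
  defines "W \<equiv> \<lambda>x. \<Sum>e\<in>nsets K 2. g e * of_real (chi e x)"
  shows "norm (rad V (\<lambda>x. exp (W x))) \<le>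
    exp (Re (rad V (\<lambda>x. W x ^ 2)) / 2 + Re (rad V (\<lambda>x. W x ^ 3)) / 6 + 7 * (2 * real (card K) * r) ^ 4)"
proof -
  define m where "m = real (card K)"
  define q where "q = 2 * m * r"
  have K: "finite K" using V finite_subset by blast
  have m: "1 \<le> m" using V K by (auto simp: m_def card_gt_0_iff Suc_le_eq)
  have q01: "0 \<le> q" "q \<le> 1" using q g(2) by (auto simp: q_def m_def)
  interpret weights "{-1, 1::real}" "\<lambda>_ _. 1/2" V
    using V by (intro weights_rad)
  define R where "R = rad V (\<lambda>x. exp (W x) - (1 + W x + W x ^ 2 /\<^sub>R 2 + W x ^ 3 /\<^sub>R 6))"
  have R: "norm R \<le> 2 * q ^ 4"
    unfolding R_def W_def q_def m_def using assms by (intro rad_exp_remainder) auto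
  have W: "norm (rad V (\<lambda>x. W x ^ j)) \<le> r ^ j * rad V (\<lambda>x. chi_sum K x ^ j)" for j
    unfolding W_def chi_sum_def using V K g
    by (intro norm_rad_power_le) (auto simp: nsets_def finite_imp_finite_nsets)
  have W1: "rad V W = 0"
    using W[of 1] rad_chi_sum_powers(1)[OF V(1,2)] by simp
  define w2 where "w2 = rad V (\<lambda>x. W x ^ 2)"
  define w3 where "w3 = rad V (\<lambda>x. W x ^ 3)"
  have "norm w2 \<le> r ^ 2 * (m * (m - 1) / 2)"
    using W[of 2] rad_chi_sum_powers(2)[OF V(1,2)] by (simp add: w2_def m_def)
  also have "\<dots> \<le> r ^ 2 * (m * m / 2)"
    using m by (intro mult_left_mono divide_right_mono) auto
  also have "\<dots> = q ^ 2 / 8" by (simp add: q_def power2_eq_square)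
  finally have w2: "norm w2 \<le> q ^ 2 / 8" .
  have "norm w3 \<le> r ^ 3 * (m * (m - 1) * (m - 2))"
    using W[of 3] rad_chi_sum_powers(3)[OF V(1,2)] by (simp add: w3_def m_def)
  also have "m * (m - 1) * (m - 2) \<le> m * m * m"
    using m by (simp add: algebra_simps)
  then have "r ^ 3 * (m * (m - 1) * (m - 2)) \<le> r ^ 3 * (m * m * m)"
    using g(2) by (intro mult_left_mono) auto
  also have "\<dots> = q ^ 3 / 8" by (simp add: q_def power3_eq_cube)
  finally have w3: "norm w3 \<le> q ^ 3 / 8" .
  have q_pow: "q ^ 3 \<le> q ^ 2" "q ^ 4 \<le> q ^ 2"
    using q01 by (auto intro!: power_decreasing)
  define X where "X = w2 / 2 + w3 / 6 + R"
  have "rad V (\<lambda>x. exp (W x)) = rad V (\<lambda>x. (exp (W x) - (1 + W x + W x ^ 2 /\<^sub>R 2 + W x ^ 3 /\<^sub>R 6))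
      + (1 + W x + (1/2) * W x ^ 2 + (1/6) * W x ^ 3))"
    by (simp add: scaleR_conv_of_real)
  also have "\<dots> = R + (1 + rad V W + (1/2) * w2 + (1/6) * w3)"
    unfolding R_def w2_def w3_def rad_def pexp_add pexp_mult_left pexp_const by simp
  finally have eq: "rad V (\<lambda>x. exp (W x)) = 1 + X"
    by (simp add: W1 X_def)
  have "norm X \<le> norm (w2 / 2) + norm (w3 / 6) + norm R"
    unfolding X_def by (intro norm_triangle_le add_mono order.refl)
  also have "\<dots> \<le> q ^ 2 / 16 + q ^ 3 / 48 + 2 * q ^ 4"
    using w2 w3 R by (simp add: norm_divide)
  also have "\<dots> \<le> 3 * q ^ 2" using q_pow zero_le_power2[of q] by linarith
  finally have "(norm X)\<^sup>2 \<le> (3 * q ^ 2)\<^sup>2" by (intro power_mono) auto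
  then have X2: "(norm X)\<^sup>2 \<le> 9 * q ^ 4" by (simp add: power_mult_distrib)
  have "norm (1 + X) \<le> exp (Re X + (norm X)\<^sup>2 / 2)" by (rule norm_one_plus_le)
  also have "\<dots> \<le> exp (Re w2 / 2 + Re w3 / 6 + 7 * q ^ 4)"
  proof -
    have "Re R \<le> 2 * q ^ 4" using R complex_Re_le_cmod[of R] by linarith
    moreover have "Re X = Re w2 / 2 + Re w3 / 6 + Re R" by (simp add: X_def)
    moreover have "0 \<le> q ^ 4" by simp
    ultimately have "Re X + (norm X)\<^sup>2 / 2 \<le> Re w2 / 2 + Re w3 / 6 + 7 * q ^ 4"
      using X2 by linarith
    then show ?thesis by simp
  qed
  finally show ?thesis unfolding eq w2_def w3_def q_def m_def .
qed

section \<open>Correlations of edge characters\<close>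

text \<open>For edges, \<open>closed3\<close> indicates that the three edges form a triangle.\<close>

definition closed3 :: "'a set \<Rightarrow> 'a set \<Rightarrow> 'a set \<Rightarrow> real" where
  "closed3 e1 e2 e3 = (if e3 = sym_diff e1 e2 then 1 else 0)"

lemma rad_chi:
  assumes "finite V" "e \<subseteq> V"
  shows "rad V (chi e) = (if e = {} then 1 else 0)"
proof -
  interpret weights "{-1, 1::real}" "\<lambda>_ _. 1/2" V
    using assms by (intro weights_rad)
  have "finite e" using assms finite_subset by blast
  then show ?thesis
    using pexp_prod_subset[OF assms(2), of "\<lambda>_ b. b"]
    by (auto simp: rad_def chi_def[abs_def] prod_constant)
qed

text \<open>The sign of a common vertex occurs twice and cancels as a square.\<close>

lemma chi_mult:
  assumes "finite V" "e1 \<subseteq> V" "e2 \<subseteq> V" "x \<in> Pi\<^sub>E V (\<lambda>_. {-1, 1})"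
  shows "chi e1 x * chi e2 x = chi (sym_diff e1 e2) x"
proof -
  have fin: "finite e1" "finite e2" using assms finite_subset by blast+
  have sq: "x i * x i = 1" if "i \<in> V" for i
    using PiE_mem[OF assms(4) that] by auto
  have "chi e1 x * chi e2 x = (chi (e1 - e2) x * chi (e1 \<inter> e2) x) * (chi (e2 - e1) x * chi (e1 \<inter> e2) x)"
    unfolding chi_def using fin
    by (metis Diff_disjoint Int_Diff_disjoint Int_commute Un_Diff_Int finite_Diff finite_Int prod.union_disjoint)
  also have "\<dots> = chi (e1 - e2) x * chi (e2 - e1) x * (\<Prod>i\<in>e1 \<inter> e2. x i * x i)"
    by (simp add: chi_def prod.distrib)
  also have "(\<Prod>i\<in>e1 \<inter> e2. x i * x i) = 1"
    using assms sq by (intro prod.neutral) auto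
  also have "chi (e1 - e2) x * chi (e2 - e1) x = chi (sym_diff e1 e2) x"
    unfolding chi_def using fin by (subst prod.union_disjoint) auto
  finally show ?thesis by simp
qed

lemma rad_chi_mult_2:
  assumes "finite V" "e1 \<subseteq> V" "e2 \<subseteq> V"
  shows "rad V (\<lambda>x. chi e1 x * chi e2 x) = (if e1 = e2 then 1 else 0)"
proof -
  have "rad V (\<lambda>x. chi e1 x * chi e2 x) = rad V (chi (sym_diff e1 e2))"
    unfolding rad_def using assms by (intro pexp_cong chi_mult)
  also have "\<dots> = (if sym_diff e1 e2 = {} then 1 else 0)"
    using assms by (intro rad_chi) auto
  finally show ?thesis by auto
qed

lemma rad_chi_mult_3:
  assumes "finite V" "e1 \<subseteq> V" "e2 \<subseteq> V" "e3 \<subseteq> V"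
  shows "rad V (\<lambda>x. chi e1 x * chi e2 x * chi e3 x) = closed3 e1 e2 e3"
proof -
  have "rad V (\<lambda>x. chi e1 x * chi e2 x * chi e3 x) = rad V (\<lambda>x. chi (sym_diff e1 e2) x * chi e3 x)"
    unfolding rad_def using assms by (intro pexp_cong) (simp add: chi_mult)
  also have "\<dots> = (if sym_diff e1 e2 = e3 then 1 else 0)"
    using assms by (intro rad_chi_mult_2) auto
  finally show ?thesis by (auto simp: closed3_def)
qed

text \<open>Parseval's identity without conjugation: a complex coefficient enters through its
  square, not its squared norm, so random coefficients with vanishing second moment remove this term
  on average.\<close>

lemma rad_square_sum:
  fixes g :: "'a set \<Rightarrow> 'c::{real_algebra_1,comm_ring_1}"
  assumes "finite V" "finite F" "\<And>e. e \<in> F \<Longrightarrow> e \<subseteq> V"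
  shows "rad V (\<lambda>x. (\<Sum>e\<in>F. g e * of_real (chi e x)) ^ 2) = (\<Sum>e\<in>F. g e ^ 2)"
proof -
  have "rad V (\<lambda>x. (\<Sum>e\<in>F. g e * of_real (chi e x)) ^ 2)
      = rad V (\<lambda>x. \<Sum>e\<in>F. \<Sum>e'\<in>F. g e * g e' * of_real (chi e x * chi e' x))"
    by (simp add: power2_eq_square sum_product mult_ac)
  also have "\<dots> = (\<Sum>e\<in>F. \<Sum>e'\<in>F. g e * g e' * of_real (rad V (\<lambda>x. chi e x * chi e' x)))"
    unfolding rad_def pexp_sum pexp_mult_left pexp_of_real ..
  also have "\<dots> = (\<Sum>e\<in>F. \<Sum>e'\<in>F. if e = e' then g e ^ 2 else 0)"
    using assms by (intro sum.cong refl) (auto simp: rad_chi_mult_2 power2_eq_square)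
  also have "\<dots> = (\<Sum>e\<in>F. g e ^ 2)"
    using assms by simp
  finally show ?thesis .
qed

text \<open>By orthogonality only triples whose characters multiply to the trivial one
  survive.\<close>

lemma rad_cube_sum:
  fixes g :: "'a set \<Rightarrow> 'c::{real_algebra_1,comm_ring_1}"
  assumes "finite V" "finite F" "\<And>e. e \<in> F \<Longrightarrow> e \<subseteq> V"
  shows "rad V (\<lambda>x. (\<Sum>e\<in>F. g e * of_real (chi e x)) ^ 3) =
    (\<Sum>e1\<in>F. \<Sum>e2\<in>F. \<Sum>e3\<in>F. of_real (closed3 e1 e2 e3) * (g e1 * g e2 * g e3))"
proof -
  have "rad V (\<lambda>x. (\<Sum>e\<in>F. g e * of_real (chi e x)) ^ 3)
      = rad V (\<lambda>x. \<Sum>e1\<in>F. \<Sum>e2\<in>F. \<Sum>e3\<in>F. g e1 * g e2 * g e3 * of_real (chi e1 x * chi e2 x * chi e3 x))"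
    by (simp add: power3_eq_cube sum_product sum_distrib_left sum_distrib_right mult_ac)
  also have "\<dots> = (\<Sum>e1\<in>F. \<Sum>e2\<in>F. \<Sum>e3\<in>F. g e1 * g e2 * g e3 * of_real (rad V (\<lambda>x. chi e1 x * chi e2 x * chi e3 x)))"
    unfolding rad_def pexp_sum pexp_mult_left pexp_of_real ..
  also have "\<dots> = (\<Sum>e1\<in>F. \<Sum>e2\<in>F. \<Sum>e3\<in>F. of_real (closed3 e1 e2 e3) * (g e1 * g e2 * g e3))"
    using assms by (intro sum.cong refl) (subst rad_chi_mult_3, auto simp: mult.commute)
  finally show ?thesis .
qed

text \<open>Double counting: the third moment with all coefficients 1 is this sum, and its value is
  known from the vertex recursion.\<close>

lemma sum_closed3:
  assumes "finite K"
  shows "(\<Sum>e1\<in>nsets K 2. \<Sum>e2\<in>nsets K 2. \<Sum>e3\<in>nsets K 2. closed3 e1 e2 e3) =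
    real (card K) * (real (card K) - 1) * (real (card K) - 2)"
proof -
  have "rad K (\<lambda>x. (\<Sum>e\<in>nsets K 2. 1 * of_real (chi e x)) ^ 3) =
    (\<Sum>e1\<in>nsets K 2. \<Sum>e2\<in>nsets K 2. \<Sum>e3\<in>nsets K 2. of_real (closed3 e1 e2 e3) * (1 * 1 * 1 :: real))"
    using assms by (intro rad_cube_sum) (auto simp: nsets_def finite_imp_finite_nsets)
  then show ?thesis
    using rad_chi_sum_powers(3)[OF assms order.refl] by (simp add: chi_sum_def)
qed

text \<open>Distinct edges carry independent frequencies, so the mean of a product over a triangle
  factorises.\<close>

lemma closed3_distinct:
  assumes "e1 \<noteq> {}" "e2 \<noteq> {}" "e3 \<noteq> {}" "closed3 e1 e2 e3 \<noteq> 0"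
  shows "e1 \<noteq> e2" "e1 \<noteq> e3" "e2 \<noteq> e3"
  using assms by (auto simp: closed3_def split: if_splits)

lemma closed3_commute: "closed3 e1 e2 e3 = closed3 e2 e1 e3" "closed3 e1 e2 e3 = closed3 e1 e3 e2"
  by (auto simp: closed3_def)

lemma closed3_nonneg: "0 \<le> closed3 e1 e2 e3"
  by (simp add: closed3_def)

text \<open>The edge \<open>e2\<close> must meet \<open>a\<close>, since otherwise the symmetric
  difference has four elements. At most \<open>2 * card K\<close> choices remain, and
  \<open>e3\<close> is then determined.\<close>

lemma sum_closed3_le:
  assumes "finite K" "a \<in> nsets K 2"
  shows "(\<Sum>e2\<in>nsets K 2. \<Sum>e3\<in>nsets K 2. closed3 a e2 e3) \<le> 2 * real (card K)"
proof -
  obtain u v where uv: "a = {u, v}" "u \<noteq> v" "u \<in> K" "v \<in> K" using assms(2) by (rule nsets2_E)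
  let ?I = "(\<lambda>z. {u, z}) ` K \<union> (\<lambda>z. {v, z}) ` K"
  have "(\<Sum>e3\<in>nsets K 2. closed3 a e2 e3) \<le> (if e2 \<in> ?I then 1 else 0)" if e2: "e2 \<in> nsets K 2" for e2
  proof (cases "e2 \<in> ?I")
    case True
    then show ?thesis using assms by (simp add: closed3_def finite_imp_finite_nsets)
  next
    case False
    obtain y z where yz: "e2 = {y, z}" "y \<noteq> z" "y \<in> K" "z \<in> K" using e2 by (rule nsets2_E)
    have "y \<noteq> u" "y \<noteq> v" "z \<noteq> u" "z \<noteq> v"
      using False yz by (auto simp: insert_commute)
    then have "sym_diff a e2 = {u, v, y, z}" "card {u, v, y, z} = 4"
      using uv yz by auto
    then have "closed3 a e2 e3 = 0" if "e3 \<in> nsets K 2" for e3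
      using that by (auto simp: closed3_def nsets_def)
    then show ?thesis using False by simp
  qed
  then have "(\<Sum>e2\<in>nsets K 2. \<Sum>e3\<in>nsets K 2. closed3 a e2 e3) \<le> (\<Sum>e2\<in>nsets K 2. if e2 \<in> ?I then 1 else 0)"
    by (rule sum_mono)
  also have "\<dots> = card (nsets K 2 \<inter> ?I)"
    using assms by (subst sum.inter_restrict[symmetric]) (auto intro: finite_imp_finite_nsets)
  also have "card (nsets K 2 \<inter> ?I) \<le> card ?I"
    using assms by (intro card_mono) auto
  also have "card ?I \<le> card K + card K"
    using assms by (intro order.trans[OF card_Un_le] add_mono card_image_le)
  finally show ?thesis by simp
qed

section \<open>Two real inequalities\<close>

text \<open>With weights \<open>1/4, 1/12, 1/3, 1/3\<close> on the frequencies \<open>0, 4, 1 \<plusminus> \<i>\<surd>3\<close> the first three moments are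
  \<open>1, 0, 0\<close>: the mixture agrees with \<open>1 + u\<close> up to third order.\<close>

definition Phi :: "real \<Rightarrow> real" where
  "Phi u = 1/4 + exp (4 * u) / 12 + 2/3 * (exp u * cos (sqrt 3 * u))"

text \<open>Up to the positive factor \<open>4/3 * exp u\<close> this is the second derivative of
  \<open>Phi\<close>. For \<open>u \<ge> 0\<close> first-order bounds suffice; for negative
  \<open>u\<close> the range is split.\<close>

lemma Phi_second_deriv_nonneg:
  fixes u :: real
  assumes "-1 \<le> u"
  shows "0 \<le> exp (3 * u) - cos (sqrt 3 * u) - sqrt 3 * sin (sqrt 3 * u)"
proof (cases "0 \<le> u")
  case True
  have "sqrt 3 * sin (sqrt 3 * u) \<le> sqrt 3 * (sqrt 3 * u)"
    using True by (intro mult_left_mono sin_x_le_x) auto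
  moreover have "sqrt 3 * (sqrt 3 * u) = 3 * u" by (simp flip: mult.assoc)
  moreover have "1 + 3 * u \<le> exp (3 * u)" by (rule exp_ge_add_one_self)
  moreover have "cos (sqrt 3 * u) \<le> 1" by simp
  ultimately show ?thesis by linarith
next
  case False
  define x where "x = - u"
  define y where "y = sqrt 3 * x"
  have x: "0 < x" "x \<le> 1" using False assms by (auto simp: x_def)
  have sqrt3: "173/100 \<le> sqrt (3::real)" "sqrt (3::real) \<le> 2"
    by (rule real_le_rsqrt, simp add: power2_eq_square, rule real_le_lsqrt, auto)
  have "y \<le> 2 * 1"
    unfolding y_def using x sqrt3 by (intro mult_mono) auto
  then have y: "0 < y" "y < pi"
    using x pi_gt3 by (auto simp: y_def)
  have y2: "y ^ 2 = 3 * x ^ 2" by (simp add: y_def power_mult_distrib)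
  have "0 \<le> exp (- 3 * x) - cos y + sqrt 3 * sin y"
  \<comment> \<open>Up to 0.92 Taylor polynomials suffice: constant and linear terms cancel, and
    \<open>6 - 6 * x - 9/24 * x\<^sup>2\<close> is still positive. Beyond 0.92 the angle
    \<open>y\<close> exceeds \<open>pi / 2\<close>, so the cosine is at most 0.\<close>
  proof (cases "x \<le> 92/100")
    case True
    have "cos y \<le> 1 - y\<^sup>2 / 2 + y ^ 4 / 24"
    proof -
      obtain t where "cos y = (\<Sum>m<4. cos_coeff m * y ^ m) + cos (t + 1/2 * real 4 * pi) / fact 4 * y ^ 4"
        using Maclaurin_cos_expansion[of y 4] by blast
      moreover have "cos (t + 1/2 * real 4 * pi) * y ^ 4 \<le> 1 * y ^ 4"
        by (intro mult_right_mono) auto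
      ultimately show ?thesis
        by (simp add: cos_coeff_def lessThan_nat_numeral fact_numeral)
    qed
    also have "\<dots> = 1 - 3/2 * x\<^sup>2 + 9/24 * x ^ 4"
      using y2 power_mult[of y 2 2] by (simp add: power_mult_distrib)
    finally have c: "cos y \<le> 1 - 3/2 * x\<^sup>2 + 9/24 * x ^ 4" .
    have "\<bar>sin y - y\<bar> \<le> y ^ 3 / 6"
      using Maclaurin_sin_bound[of y 3] y by (simp add: sin_coeff_def eval_nat_numeral)
    then have "y - y ^ 3 / 6 \<le> sin y" by linarith
    then have "sqrt 3 * (y - y ^ 3 / 6) \<le> sqrt 3 * sin y"
      by (rule mult_left_mono) simp
    also have "sqrt 3 * (y - y ^ 3 / 6) = sqrt 3 * y * (1 - y ^ 2 / 6)"
      by (simp add: power3_eq_cube power2_eq_square algebra_simps)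
    also have "\<dots> = 3 * x - 3/2 * x ^ 3"
      unfolding y2 by (simp add: y_def power3_eq_cube power2_eq_square algebra_simps)
    finally have s: "3 * x - 3/2 * x ^ 3 \<le> sqrt 3 * sin y" .
    obtain t where "exp (- 3 * x) = (\<Sum>m<4. (- 3 * x) ^ m / fact m) + exp t / fact 4 * (- 3 * x) ^ 4"
      using Maclaurin_exp_le[of "- 3 * x" 4] by blast
    moreover have "0 \<le> exp t / fact 4 * (- 3 * x) ^ 4" by simp
    ultimately have "exp (- 3 * x) \<ge> 1 - 3 * x + 9/2 * x\<^sup>2 - 9/2 * x ^ 3"
      by (simp add: eval_nat_numeral algebra_simps)
    with c s have "exp (- 3 * x) - cos y + sqrt 3 * sin y \<ge> x\<^sup>2 * (6 - 6 * x - 9/24 * x\<^sup>2)"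
      by (simp add: algebra_simps power2_eq_square power3_eq_cube power4_eq_xxxx)
    moreover have "x\<^sup>2 \<le> (92/100)\<^sup>2" using True x by (intro power_mono) auto
    then have "0 \<le> x\<^sup>2 * (6 - 6 * x - 9/24 * x\<^sup>2)"
      using True by (intro mult_nonneg_nonneg) (auto simp: power2_eq_square)
    ultimately show ?thesis by linarith
  next
    case False
    have "173/100 * (92/100) \<le> y"
      unfolding y_def using False sqrt3 by (intro mult_mono) auto
    moreover have "pi \<le> 3.15" using pi_approx(2) by simp
    ultimately have "pi / 2 \<le> y" by simp
    then have "cos y \<le> 0" using y cos_monotone_0_pi_le[of "pi/2" y] by simp
    moreover have "0 \<le> sin y" using y by (intro sin_ge_zero) auto
    then have "0 \<le> sqrt 3 * sin y" by simp
    ultimately show ?thesis by (smt (verit) exp_gt_zero)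
  qed
  then show ?thesis by (simp add: y_def x_def)
qed


text \<open>On \<open>[-1, \<infinity>)\<close> the function is convex and \<open>1 + u\<close> is
  its tangent at 0. To the left of -1 only nonnegativity is claimed.\<close>

lemma Phi_ge_tangent: "max 0 (1 + u) \<le> Phi u"
proof (cases "-1 \<le> u")
  case False
  have "exp u \<le> exp (-1 :: real)" using False by simp
  \<comment> \<open>The value 3/8 makes the oscillating term at most \<open>2/3 * 3/8 = 1/4\<close>,
    the constant term of \<open>Phi\<close>.\<close>
  also have "\<dots> \<le> 3/8"
  proof -
    obtain t where "exp 1 = (\<Sum>m<4. 1 ^ m / fact m) + exp t / fact 4 * (1::real) ^ 4"
      using Maclaurin_exp_le[of 1 4] by blast
    moreover have "0 \<le> exp t / fact 4 * (1::real) ^ 4" by simp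
    ultimately have "8/3 \<le> exp (1 :: real)" by (simp add: eval_nat_numeral)
    then show ?thesis by (simp add: exp_minus field_simps)
  qed
  finally have "\<bar>exp u * cos (sqrt 3 * u)\<bar> \<le> 3/8 * 1"
    unfolding abs_mult by (intro mult_mono) auto
  moreover have "0 \<le> exp (4 * u)" by simp
  ultimately have "0 \<le> Phi u" unfolding Phi_def by linarith
  then show ?thesis using False by simp
next
  case True
  define f where "f u = 4 * exp (4 * u) / 12 + 2/3 * (exp u * cos (sqrt 3 * u) - sqrt 3 * exp u * sin (sqrt 3 * u))" for u :: real
  define g where "g u = 4/3 * (exp (4 * u) - exp u * (cos (sqrt 3 * u) + sqrt 3 * sin (sqrt 3 * u)))" for u :: real
  have "Phi u - Phi 0 \<ge> f 0 * (u - 0)"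
  proof (rule convex_on_imp_above_tangent)
    show "convex_on {-1..} Phi"
    proof (rule f''_ge0_imp_convex)
      show "DERIV Phi x :> f x" for x
        unfolding Phi_def f_def by (auto intro!: derivative_eq_intros simp: field_simps)
      show "DERIV f x :> g x" for x
      proof -
        have "sqrt 3 * (sqrt 3 * y) = 3 * y" for y :: real by (simp flip: mult.assoc)
        then show ?thesis
          unfolding f_def g_def by (auto intro!: derivative_eq_intros simp: field_simps)
      qed
      show "0 \<le> g x" if "x \<in> {-1..}" for x
      proof -
        have "exp (4 * x) = exp x * exp (3 * x)" by (simp flip: exp_add)
        then have "g x = 4/3 * exp x * (exp (3 * x) - cos (sqrt 3 * x) - sqrt 3 * sin (sqrt 3 * x))"
          by (simp add: g_def algebra_simps)
        moreover have "0 \<le> exp (3 * x) - cos (sqrt 3 * x) - sqrt 3 * sin (sqrt 3 * x)"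
          using that by (intro Phi_second_deriv_nonneg) simp
        then have "0 \<le> 4/3 * exp x * (exp (3 * x) - cos (sqrt 3 * x) - sqrt 3 * sin (sqrt 3 * x))"
          by (intro mult_nonneg_nonneg) auto
        ultimately show ?thesis by simp
      qed
    qed auto
    show "(Phi has_real_derivative f 0) (at 0 within {-1..})"
      unfolding Phi_def f_def by (auto intro!: derivative_eq_intros simp: field_simps)
  qed (use True in \<open>auto simp: interior_real_atLeast\<close>)
  then have "1 + u \<le> Phi u" by (simp add: Phi_def f_def)
  then show ?thesis using True by simp
qed

text \<open>The difference of the two sides is concave on \<open>(0, 1/2)\<close> and vanishes at both ends.\<close>

lemma square_mult_ln_less:
  fixes p :: real
  assumes "0 < p" "p < 1/2"
  shows "p\<^sup>2 * (- ln p) < (1 - p)\<^sup>2 * (- ln (1 - p))"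
proof (rule ccontr)
  assume neg: "\<not> ?thesis"
  define F where "F x = (1 - x)\<^sup>2 * (- ln (1 - x)) - x\<^sup>2 * (- ln x)" for x :: real
  define G where "G x = 2 * (1 - x) * ln (1 - x) + (1 - x) + 2 * x * ln x + x" for x :: real
  have F: "(F has_real_derivative G x) (at x)" if "0 < x" "x < 1" for x
    unfolding F_def G_def using that
    by (auto intro!: derivative_eq_intros simp: divide_simps power2_eq_square) (auto simp: algebra_simps)
  have G: "(G has_real_derivative 2 * ln x - 2 * ln (1 - x)) (at x)" if "0 < x" "x < 1" for x
    unfolding G_def using that
    by (auto intro!: derivative_eq_intros simp: divide_simps) (auto simp: algebra_simps)
  have G_dec: "G y < G x" if "0 < x" "x < y" "y \<le> 1/2" for x y
  proof (rule DERIV_neg_imp_decreasing_open[OF that(2)])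
    fix t assume "x < t" "t < y"
    then show "\<exists>d. (G has_real_derivative d) (at t) \<and> d < 0"
      using that by (intro exI[of _ "2 * ln t - 2 * ln (1 - t)"] conjI G) auto
  next
    show "continuous_on {x..y} G"
      using that by (intro DERIV_continuous_on[of _ _ "\<lambda>t. 2 * ln t - 2 * ln (1 - t)"] has_field_derivative_at_within[OF G]) auto
  qed
  have "F p \<le> 0" using neg by (simp add: F_def)
  \<comment> \<open>If \<open>F p \<le> 0\<close>, the mean value theorem up to the zero at 1/2
    gives a nonnegative slope to the right of \<open>p\<close>. As the slope \<open>G\<close>
    decreases, \<open>F\<close> increases strictly on \<open>(0, p]\<close> from its limit 0, so
    \<open>F p\<close> is positive, a contradiction.\<close>
  have "\<exists>z>p. z < 1/2 \<and> F (1/2) - F p = (1/2 - p) * G z"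
    using assms by (intro MVT2 F) auto
  then obtain z where z: "p < z" "z < 1/2" "F (1/2) - F p = (1/2 - p) * G z" by blast
  have "F (1/2) = 0" by (simp add: F_def)
  with z \<open>F p \<le> 0\<close> assms have "0 \<le> G z"
    by (metis diff_0 diff_gt_0_iff_gt neg_0_le_iff_le zero_le_mult_iff linorder_not_less)
  then have G_pos: "0 < G x" if "0 < x" "x \<le> p" for x
    using G_dec[of x z] that z by auto
  have F_inc: "F x < F y" if "0 < x" "x < y" "y \<le> p" for x y
  proof (rule DERIV_pos_imp_increasing_open[OF that(2)])
    fix t assume "x < t" "t < y"
    then show "\<exists>d. (F has_real_derivative d) (at t) \<and> 0 < d"
      using that assms by (intro exI[of _ "G t"] conjI F G_pos) auto
  next
    show "continuous_on {x..y} F"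
      using that assms by (intro DERIV_continuous_on[of _ _ G] has_field_derivative_at_within[OF F]) auto
  qed
  have "(F \<longlongrightarrow> 0) (at_right 0)"
    unfolding F_def by real_asymp
  moreover have "eventually (\<lambda>x. F x \<le> F (p/2)) (at_right 0)"
    using eventually_at_right_real[of 0 "p/2"] assms
    by (auto elim!: eventually_mono intro!: less_imp_le F_inc)
  ultimately have "0 \<le> F (p/2)"
    by (intro tendsto_upperbound[of F 0 "at_right 0"]) auto
  moreover have "F (p/2) < F p" using assms by (intro F_inc) auto
  ultimately show False using \<open>F p \<le> 0\<close> by linarith
qed

section \<open>Clique probabilities in the correlated model\<close>

definition freqs :: "complex set" where
  "freqs = {0, 4, Complex 1 (sqrt 3), Complex 1 (- sqrt 3)}"

definition freq_weight :: "complex \<Rightarrow> real" where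
  "freq_weight g = (if g = 0 then 1/4 else if g = 4 then 1/12 else 1/3)"

lemma sum_freqs:
  "(\<Sum>g\<in>freqs. freq_weight g *\<^sub>R F g) = (1/4) *\<^sub>R F 0 + (1/12) *\<^sub>R F 4
    + (1/3) *\<^sub>R F (Complex 1 (sqrt 3)) + (1/3) *\<^sub>R F (Complex 1 (- sqrt 3))"
  by (simp add: freqs_def freq_weight_def complex_eq_iff add.assoc)

text \<open>Mean 1 keeps the triangle term intact. The vanishing second moment removes the quadratic
  term of the exponent, whose order \<eta>^2 l^2 would swamp the gain of order \<eta>^3 l^2.\<close>

lemma freq_moments:
  "(\<Sum>g\<in>freqs. freq_weight g) = 1"
  "(\<Sum>g\<in>freqs. freq_weight g *\<^sub>R g) = 1"
  "(\<Sum>g\<in>freqs. freq_weight g *\<^sub>R g ^ 2) = 0"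
  using sum_freqs[of "\<lambda>_. 1 :: real"]
  by (simp_all add: sum_freqs complex_eq_iff power2_eq_square)

lemma Phi_eq_sum_freqs:
  "complex_of_real (Phi u) = (\<Sum>g\<in>freqs. freq_weight g *\<^sub>R exp (g * of_real u))"
  by (simp add: sum_freqs Phi_def complex_eq_iff Re_exp Im_exp)

lemma norm_freq_le: "g \<in> freqs \<Longrightarrow> norm g \<le> 4"
  by (auto simp: freqs_def cmod_def real_le_lsqrt)

lemma finite_freqs: "finite freqs"
  by (simp add: freqs_def)

text \<open>The vectors are stored by coordinate: \<open>x c\<close> lists the \<open>c\<close>-th
  signs of all vertices, so the inner product of the vectors of \<open>i\<close> and
  \<open>j\<close> is the sum over \<open>c\<close> of \<open>chi {i, j} (x c)\<close>, and the
  coordinates are independent.\<close>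

definition cloud_exp :: "nat \<Rightarrow> 'a set \<Rightarrow> ((nat \<Rightarrow> 'a \<Rightarrow> real) \<Rightarrow> 'c::real_vector) \<Rightarrow> 'c" where
  "cloud_exp d V = pexp (Pi\<^sub>E V (\<lambda>_. {-1, 1})) (\<lambda>_ _. (1/2) ^ card V) {..<d}"

lemma cloud_weights: 
  assumes "finite V"
  shows "weights (Pi\<^sub>E V (\<lambda>_. {-1, 1::real})) (\<lambda>_ _. (1/2) ^ card V) {..<d::nat}"
proof
  show "finite (Pi\<^sub>E V (\<lambda>_. {-1, 1::real}))" using assms by (intro finite_PiE) auto
  interpret weights "{-1, 1::real}" "\<lambda>_ _. 1/2" V
    using assms by (intro weights_rad)
  show "(\<Sum>b\<in>Pi\<^sub>E V (\<lambda>_. {-1, 1::real}). (1/2::real) ^ card V) = 1"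
    using pexp_const[of "1::real"] by (simp add: pexp_def)
qed auto

lemma cloud_exp_prod:
  fixes F :: "('a \<Rightarrow> real) \<Rightarrow> 'c::{real_algebra_1,comm_ring_1}"
  assumes "finite V"
  shows "cloud_exp d V (\<lambda>x. \<Prod>c<d. F (x c)) = rad V F ^ d"
  using assms unfolding cloud_exp_def
  by (subst pexp_prod[where g = "\<lambda>_. F"]) (auto simp: rad_def pexp_def intro!: finite_PiE)

text \<open>Writing each \<open>Phi\<close> as a mixture over a random frequency of its edge turns
  the product into exponentials of sums over the coordinates. After exchanging the two expectations
  the inner one factorises into a \<open>d\<close>-th power.\<close>

lemma cloud_exp_Phi_le_pexp:
  fixes \<tau> :: real
  assumes "finite V" "K \<subseteq> V"
  defines "E \<equiv> nsets K 2"
  defines "W \<equiv> \<lambda>\<gamma> x. \<Sum>e\<in>E. (of_real \<tau> * \<gamma> e) * complex_of_real (chi e x)"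
  shows "cloud_exp d V (\<lambda>x. \<Prod>e\<in>E. Phi (\<tau> * (\<Sum>c<d. chi e (x c))))
    \<le> pexp freqs (\<lambda>_. freq_weight) E (\<lambda>\<gamma>. norm (rad V (\<lambda>x. exp (W \<gamma> x))) ^ d)"
proof -
  have E: "finite E"
    unfolding E_def using assms(1,2) finite_subset by (intro finite_imp_finite_nsets)
  interpret weights freqs "\<lambda>_. freq_weight" E
    using E finite_freqs freq_moments(1) by unfold_locales (auto simp: freq_weight_def)
  have *: "complex_of_real (\<Prod>e\<in>E. Phi (\<tau> * (\<Sum>c<d. chi e (x c))))
      = pexp freqs (\<lambda>_. freq_weight) E (\<lambda>\<gamma>. \<Prod>c<d. exp (W \<gamma> (x c)))" for x :: "nat \<Rightarrow> 'a \<Rightarrow> real"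
  proof -
    have "complex_of_real (\<Prod>e\<in>E. Phi (\<tau> * (\<Sum>c<d. chi e (x c))))
        = (\<Prod>e\<in>E. \<Sum>g\<in>freqs. freq_weight g *\<^sub>R exp (g * of_real (\<tau> * (\<Sum>c<d. chi e (x c)))))"
      by (simp only: of_real_prod Phi_eq_sum_freqs)
    also have "\<dots> = pexp freqs (\<lambda>_. freq_weight) E
        (\<lambda>\<gamma>. \<Prod>e\<in>E. exp (\<gamma> e * of_real (\<tau> * (\<Sum>c<d. chi e (x c)))))"
      by (rule pexp_prod[symmetric, OF E finite_freqs])
    also have "\<dots> = pexp freqs (\<lambda>_. freq_weight) E (\<lambda>\<gamma>. \<Prod>c<d. exp (W \<gamma> (x c)))"
    proof (rule pexp_cong)
      fix \<gamma> :: "'a set \<Rightarrow> complex"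
      have "(\<Sum>e\<in>E. \<gamma> e * of_real (\<tau> * (\<Sum>c<d. chi e (x c)))) = (\<Sum>c<d. W \<gamma> (x c))"
        unfolding W_def by (subst sum.swap) (simp add: sum_distrib_left mult_ac)
      then show "(\<Prod>e\<in>E. exp (\<gamma> e * of_real (\<tau> * (\<Sum>c<d. chi e (x c))))) = (\<Prod>c<d. exp (W \<gamma> (x c)))"
        using E by (simp flip: exp_sum)
    qed
    finally show ?thesis .
  qed
  have "complex_of_real (cloud_exp d V (\<lambda>x. \<Prod>e\<in>E. Phi (\<tau> * (\<Sum>c<d. chi e (x c)))))
      = cloud_exp d V (\<lambda>x. pexp freqs (\<lambda>_. freq_weight) E (\<lambda>\<gamma>. \<Prod>c<d. exp (W \<gamma> (x c))))"
    unfolding cloud_exp_def pexp_of_real[symmetric] * ..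
  also have "\<dots> = pexp freqs (\<lambda>_. freq_weight) E (\<lambda>\<gamma>. cloud_exp d V (\<lambda>x. \<Prod>c<d. exp (W \<gamma> (x c))))"
    unfolding cloud_exp_def by (rule pexp_swap)
  also have "\<dots> = pexp freqs (\<lambda>_. freq_weight) E (\<lambda>\<gamma>. rad V (\<lambda>x. exp (W \<gamma> x)) ^ d)"
    by (rule pexp_cong) (rule cloud_exp_prod[OF assms(1), where F = "\<lambda>y. exp (W _ y)"])
  finally have "norm (complex_of_real (cloud_exp d V (\<lambda>x. \<Prod>e\<in>E. Phi (\<tau> * (\<Sum>c<d. chi e (x c))))))
      \<le> pexp freqs (\<lambda>_. freq_weight) E (\<lambda>\<gamma>. norm (rad V (\<lambda>x. exp (W \<gamma> x)) ^ d))"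
    using norm_pexp by simp
  then show ?thesis by (simp add: norm_power)
qed

text \<open>The three terms of the exponent are the triangle term, the fourth-order error of
  \<open>norm_rad_exp_le\<close> with coefficients of norm at most
  \<open>4 * \<bar>\<tau>\<bar>\<close>, and the bounded-differences cost of averaging over the
  frequencies.\<close>

lemma cloud_exp_Phi_le:
  fixes \<tau> :: real
  assumes V: "finite V" "K \<subseteq> V" "K \<noteq> {}"
  defines "m \<equiv> real (card K)"
  assumes small: "8 * m * \<bar>\<tau>\<bar> \<le> 1" "32 * real d * \<tau>\<^sup>2 \<le> 1"
  shows "cloud_exp d V (\<lambda>x. \<Prod>e\<in>nsets K 2. Phi (\<tau> * (\<Sum>c<d. chi e (x c))))
    \<le> exp (real d * \<tau> ^ 3 * (m * (m - 1) * (m - 2)) / 6 + 7 * real d * (8 * m * \<tau>) ^ 4 + 512 * m\<^sup>2 * (real d)\<^sup>2 * \<tau> ^ 4)"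
proof -
  define E where "E = nsets K 2"
  define W where "W \<gamma> x = (\<Sum>e\<in>E. (of_real \<tau> * \<gamma> e) * complex_of_real (chi e x))" for \<gamma> x
  let ?P = "pexp freqs (\<lambda>_. freq_weight) E"
  have K: "finite K" using V finite_subset by blast
  have E: "finite E" "\<And>e. e \<in> E \<Longrightarrow> e \<subseteq> V" "\<And>e. e \<in> E \<Longrightarrow> e \<noteq> {}"
    using K V by (auto simp: E_def nsets_def intro: finite_imp_finite_nsets)
  have m: "1 \<le> m" using V K by (auto simp: m_def card_gt_0_iff Suc_le_eq)
  interpret weights freqs "\<lambda>_. freq_weight" E
    using E finite_freqs freq_moments(1) by unfold_locales (auto simp: freq_weight_def)
  \<comment> \<open>For fixed frequencies, \<open>f\<close> is the second- and third-order part of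
    the exponent, \<open>T\<close> its sum over triangles, and \<open>c\<close> bounds the effect on
    \<open>f\<close> of changing one frequency.\<close>
  define T where "T \<gamma> = (\<Sum>e1\<in>E. \<Sum>e2\<in>E. \<Sum>e3\<in>E. closed3 e1 e2 e3 * Re (\<gamma> e1 * \<gamma> e2 * \<gamma> e3))" for \<gamma>
  define f where "f \<gamma> = real d * (\<tau>\<^sup>2 / 2 * (\<Sum>e\<in>E. Re (\<gamma> e ^ 2)) + \<tau> ^ 3 / 6 * T \<gamma>)" for \<gamma>
  define c where "c = 32 * real d * \<tau>\<^sup>2"
  have W_le: "norm (rad V (\<lambda>x. exp (W \<gamma> x))) ^ d \<le> exp (7 * real d * (8 * m * \<tau>) ^ 4) * exp (f \<gamma>)"
    if \<gamma>: "\<gamma> \<in> Pi\<^sub>E E (\<lambda>_. freqs)" for \<gamma>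
  proof -
    have "norm (rad V (\<lambda>x. exp (W \<gamma> x))) \<le>
        exp (Re (rad V (\<lambda>x. W \<gamma> x ^ 2)) / 2 + Re (rad V (\<lambda>x. W \<gamma> x ^ 3)) / 6 + 7 * (2 * real (card K) * (4 * \<bar>\<tau>\<bar>)) ^ 4)"
      unfolding W_def E_def
    proof (rule norm_rad_exp_le[OF V])
      fix e assume "e \<in> nsets K 2"
      then have "norm (\<gamma> e) \<le> 4" using \<gamma> by (intro norm_freq_le) (auto simp: E_def)
      then show "norm (of_real \<tau> * \<gamma> e) \<le> 4 * \<bar>\<tau>\<bar>"
        by (simp add: norm_mult mult.commute[of 4] mult_left_mono)
    qed (use small in \<open>auto simp: m_def\<close>)
    also have "rad V (\<lambda>x. W \<gamma> x ^ 2) = (\<Sum>e\<in>E. (of_real \<tau> * \<gamma> e) ^ 2)"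
      unfolding W_def using V E by (intro rad_square_sum) auto
    also have "Re \<dots> = \<tau>\<^sup>2 * (\<Sum>e\<in>E. Re (\<gamma> e ^ 2))"
      by (simp add: power_mult_distrib sum_distrib_left flip: of_real_power)
    also have "rad V (\<lambda>x. W \<gamma> x ^ 3) = (\<Sum>e1\<in>E. \<Sum>e2\<in>E. \<Sum>e3\<in>E.
        of_real (closed3 e1 e2 e3) * ((of_real \<tau> * \<gamma> e1) * (of_real \<tau> * \<gamma> e2) * (of_real \<tau> * \<gamma> e3)))"
      unfolding W_def using V E by (intro rad_cube_sum) auto
    also have "\<dots> = (\<Sum>e1\<in>E. \<Sum>e2\<in>E. \<Sum>e3\<in>E. of_real (\<tau> ^ 3 * closed3 e1 e2 e3) * (\<gamma> e1 * \<gamma> e2 * \<gamma> e3))"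
      by (simp add: power3_eq_cube mult_ac)
    also have "Re \<dots> = \<tau> ^ 3 * T \<gamma>"
    proof -
      have "Re (of_real a * z) = a * Re z" for a z by simp
      then show ?thesis
        by (simp only: Re_sum T_def sum_distrib_left mult.assoc)
    qed
    also have "2 * real (card K) * (4 * \<bar>\<tau>\<bar>) = \<bar>8 * m * \<tau>\<bar>"
      using m by (simp add: m_def abs_mult)
    finally have "norm (rad V (\<lambda>x. exp (W \<gamma> x))) ^ d
        \<le> exp (\<tau>\<^sup>2 * (\<Sum>e\<in>E. Re (\<gamma> e ^ 2)) / 2 + \<tau> ^ 3 * T \<gamma> / 6 + 7 * (8 * m * \<tau>) ^ 4) ^ d"
      by (intro power_mono) (auto simp: power_even_abs)
    also have "\<dots> = exp (7 * real d * (8 * m * \<tau>) ^ 4) * exp (f \<gamma>)"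
      unfolding f_def by (simp flip: exp_of_nat_mult exp_add add: algebra_simps)
    finally show ?thesis .
  qed
  have Pf: "?P f = real d * \<tau> ^ 3 * (m * (m - 1) * (m - 2)) / 6"
  proof -
    have "?P (\<lambda>\<gamma>. Re (\<gamma> e ^ 2)) = 0" if "e \<in> E" for e
    proof -
      have "?P (\<lambda>\<gamma>. Re (\<gamma> e ^ 2)) = Re (?P (\<lambda>\<gamma>. \<gamma> e ^ 2))"
        by (rule pexp_linear) (auto intro!: linearI)
      also have "?P (\<lambda>\<gamma>. \<gamma> e ^ 2) = 0"
        using pexp_prod_subset[of "{e}" "\<lambda>_ g. g ^ 2"] that freq_moments(3) by simp
      finally show ?thesis by simp
    qed
    moreover have "closed3 e1 e2 e3 * ?P (\<lambda>\<gamma>. Re (\<gamma> e1 * \<gamma> e2 * \<gamma> e3)) = closed3 e1 e2 e3"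
      if e: "e1 \<in> E" "e2 \<in> E" "e3 \<in> E" for e1 e2 e3
    proof (cases "closed3 e1 e2 e3 = 0")
      case False
      note ne = closed3_distinct[OF E(3)[OF e(1)] E(3)[OF e(2)] E(3)[OF e(3)] False]
      have "?P (\<lambda>\<gamma>. Re (\<gamma> e1 * \<gamma> e2 * \<gamma> e3)) = Re (?P (\<lambda>\<gamma>. \<gamma> e1 * \<gamma> e2 * \<gamma> e3))"
        by (rule pexp_linear) (auto intro!: linearI)
      also have "?P (\<lambda>\<gamma>. \<gamma> e1 * \<gamma> e2 * \<gamma> e3) = 1"
        using pexp_prod_subset[of "{e1, e2, e3}" "\<lambda>_ g. g"] e ne freq_moments(2)
        by (simp add: mult.assoc)
      finally show ?thesis by simp
    qed simp
    then have "?P T = m * (m - 1) * (m - 2)"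
      unfolding T_def[abs_def] pexp_sum pexp_mult_left m_def sum_closed3[OF K, symmetric] E_def
      by (intro sum.cong refl) auto
    moreover have "?P f = real d * (\<tau>\<^sup>2 / 2 * (\<Sum>e\<in>E. ?P (\<lambda>\<gamma>. Re (\<gamma> e ^ 2))) + \<tau> ^ 3 / 6 * ?P T)"
      unfolding f_def[abs_def] pexp_mult_left pexp_add pexp_sum ..
    ultimately show ?thesis by simp
  qed
  \<comment> \<open>The quadratic sum moves by at most \<open>4\<^sup>2 + 4\<^sup>2 = 32\<close>. A
    closed triple through \<open>a\<close> moves by at most \<open>2 * 4 ^ 3 = 128\<close>; with
    three positions for \<open>a\<close> and at most \<open>2 * m\<close> triples each,
    \<open>T\<close> moves by at most \<open>768 * m\<close>. Each part contributes half of
    \<open>c\<close>.\<close>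
  have diff: "\<bar>f (\<gamma>(a := b)) - f \<gamma>\<bar> \<le> c"
    if \<gamma>: "\<gamma> \<in> Pi\<^sub>E E (\<lambda>_. freqs)" "a \<in> E" "b \<in> freqs" for \<gamma> a b
  proof -
    let ?\<delta> = "\<gamma>(a := b)"
    have le4: "norm (\<gamma> e) \<le> 4" "norm (?\<delta> e) \<le> 4" if "e \<in> E" for e
      using \<gamma> that by (auto intro!: norm_freq_le)
    have "(\<Sum>e\<in>E. Re (?\<delta> e ^ 2)) - (\<Sum>e\<in>E. Re (\<gamma> e ^ 2)) = (\<Sum>e\<in>E. if e = a then Re (b ^ 2) - Re (\<gamma> a ^ 2) else 0)"
      unfolding sum_subtractf[symmetric] by (intro sum.cong) auto
    also have "\<dots> = Re (b ^ 2) - Re (\<gamma> a ^ 2)" using E \<gamma> by simp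
    also have "\<bar>\<dots>\<bar> \<le> norm (b ^ 2) + norm (\<gamma> a ^ 2)"
      by (intro order.trans[OF abs_triangle_ineq4] add_mono abs_Re_le_cmod)
    also have "\<dots> \<le> 4 ^ 2 + 4 ^ 2"
      unfolding norm_power using \<gamma> le4(1)[of a] norm_freq_le[of b] by (intro add_mono power_mono) auto
    finally have sq: "\<bar>(\<Sum>e\<in>E. Re (?\<delta> e ^ 2)) - (\<Sum>e\<in>E. Re (\<gamma> e ^ 2))\<bar> \<le> 32" by simp
    let ?h = "\<lambda>e. if e = a then 128 else (0::real)"
    have "\<bar>T ?\<delta> - T \<gamma>\<bar> = \<bar>\<Sum>e1\<in>E. \<Sum>e2\<in>E. \<Sum>e3\<in>E. closed3 e1 e2 e3 * (Re (?\<delta> e1 * ?\<delta> e2 * ?\<delta> e3) - Re (\<gamma> e1 * \<gamma> e2 * \<gamma> e3))\<bar>"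
      by (simp add: T_def sum_subtractf right_diff_distrib)
    also have "\<dots> \<le> (\<Sum>e1\<in>E. \<Sum>e2\<in>E. \<Sum>e3\<in>E. closed3 e1 e2 e3 * (?h e1 + ?h e2 + ?h e3))"
    proof (intro order.trans[OF sum_abs] sum_mono)
      fix e1 e2 e3 assume e: "e1 \<in> E" "e2 \<in> E" "e3 \<in> E"
      have "\<bar>Re (?\<delta> e1 * ?\<delta> e2 * ?\<delta> e3) - Re (\<gamma> e1 * \<gamma> e2 * \<gamma> e3)\<bar> \<le> ?h e1 + ?h e2 + ?h e3"
      proof (cases "a \<in> {e1, e2, e3}")
        case True
        have "\<bar>Re (?\<delta> e1 * ?\<delta> e2 * ?\<delta> e3) - Re (\<gamma> e1 * \<gamma> e2 * \<gamma> e3)\<bar>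
            \<le> norm (?\<delta> e1 * ?\<delta> e2 * ?\<delta> e3) + norm (\<gamma> e1 * \<gamma> e2 * \<gamma> e3)"
          by (intro order.trans[OF abs_triangle_ineq4] add_mono abs_Re_le_cmod)
        also have "\<dots> \<le> 4 * 4 * 4 + 4 * 4 * 4"
          unfolding norm_mult using le4 e by (intro add_mono mult_mono) auto
        also have "\<dots> \<le> ?h e1 + ?h e2 + ?h e3" using True by auto
        finally show ?thesis .
      qed auto
      then show "\<bar>closed3 e1 e2 e3 * (Re (?\<delta> e1 * ?\<delta> e2 * ?\<delta> e3) - Re (\<gamma> e1 * \<gamma> e2 * \<gamma> e3))\<bar>
          \<le> closed3 e1 e2 e3 * (?h e1 + ?h e2 + ?h e3)"
        using closed3_nonneg[of e1 e2 e3] by (simp only: abs_mult abs_of_nonneg mult_left_mono)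
    qed
    also have "\<dots> = (\<Sum>e1\<in>E. \<Sum>e2\<in>E. \<Sum>e3\<in>E. closed3 e1 e2 e3 * ?h e1)
        + (\<Sum>e1\<in>E. \<Sum>e2\<in>E. \<Sum>e3\<in>E. closed3 e1 e2 e3 * ?h e2)
        + (\<Sum>e1\<in>E. \<Sum>e2\<in>E. \<Sum>e3\<in>E. closed3 e1 e2 e3 * ?h e3)"
      by (simp only: distrib_left sum.distrib)
    also have "(\<Sum>e1\<in>E. \<Sum>e2\<in>E. \<Sum>e3\<in>E. closed3 e1 e2 e3 * ?h e2) = (\<Sum>e1\<in>E. \<Sum>e2\<in>E. \<Sum>e3\<in>E. closed3 e1 e2 e3 * ?h e1)"
      by (subst sum.swap) (subst closed3_commute(1), rule refl)
    also have "(\<Sum>e1\<in>E. \<Sum>e2\<in>E. \<Sum>e3\<in>E. closed3 e1 e2 e3 * ?h e3) = (\<Sum>e1\<in>E. \<Sum>e2\<in>E. \<Sum>e3\<in>E. closed3 e1 e2 e3 * ?h e2)"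
      by (rule sum.cong[OF refl], subst sum.swap) (subst closed3_commute(2), rule refl)
    also have "\<dots> = (\<Sum>e1\<in>E. \<Sum>e2\<in>E. \<Sum>e3\<in>E. closed3 e1 e2 e3 * ?h e1)"
      by (subst sum.swap) (subst closed3_commute(1), rule refl)
    also have "(\<Sum>e1\<in>E. \<Sum>e2\<in>E. \<Sum>e3\<in>E. closed3 e1 e2 e3 * ?h e1) = (\<Sum>e2\<in>E. \<Sum>e3\<in>E. closed3 a e2 e3) * 128"
    proof -
      have "(\<Sum>e1\<in>E. \<Sum>e2\<in>E. \<Sum>e3\<in>E. closed3 e1 e2 e3 * ?h e1) = (\<Sum>e1\<in>E. if e1 = a then (\<Sum>e2\<in>E. \<Sum>e3\<in>E. closed3 a e2 e3) * 128 else 0)"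
        by (intro sum.cong refl) (auto simp: sum_distrib_right)
      then show ?thesis using E \<gamma> by simp
    qed
    also have "\<dots> \<le> 2 * m * 128"
      unfolding m_def E_def using \<gamma> by (intro mult_right_mono sum_closed3_le K) (auto simp: E_def)
    finally have cube: "\<bar>T ?\<delta> - T \<gamma>\<bar> \<le> 768 * m" using m by linarith
    have "f ?\<delta> - f \<gamma> = real d * (\<tau>\<^sup>2 / 2 * ((\<Sum>e\<in>E. Re (?\<delta> e ^ 2)) - (\<Sum>e\<in>E. Re (\<gamma> e ^ 2))) + \<tau> ^ 3 / 6 * (T ?\<delta> - T \<gamma>))"
      by (simp only: f_def right_diff_distrib distrib_left)
    also have "\<bar>\<dots>\<bar> \<le> real d * (\<tau>\<^sup>2 / 2 * 32 + \<tau>\<^sup>2 * \<bar>\<tau>\<bar> / 6 * (768 * m))"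
    proof -
      have "\<bar>\<tau> ^ 3\<bar> = \<tau>\<^sup>2 * \<bar>\<tau>\<bar>"
        by (simp add: power3_eq_cube power2_eq_square abs_mult)
      then have "\<bar>\<tau> ^ 3 / 6 * (T ?\<delta> - T \<gamma>)\<bar> \<le> \<tau>\<^sup>2 * \<bar>\<tau>\<bar> / 6 * (768 * m)"
        unfolding abs_mult abs_divide using cube by (intro mult_mono) auto
      moreover have "\<bar>\<tau>\<^sup>2 / 2 * ((\<Sum>e\<in>E. Re (?\<delta> e ^ 2)) - (\<Sum>e\<in>E. Re (\<gamma> e ^ 2)))\<bar> \<le> \<tau>\<^sup>2 / 2 * 32"
        unfolding abs_mult abs_divide using sq by (intro mult_mono) auto
      ultimately show ?thesis
        unfolding abs_mult[of "real d"] abs_of_nat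
        by (intro mult_left_mono order.trans[OF abs_triangle_ineq] add_mono) auto
    qed
    also have "\<tau>\<^sup>2 * \<bar>\<tau>\<bar> / 6 * (768 * m) = 16 * \<tau>\<^sup>2 * (8 * m * \<bar>\<tau>\<bar>)"
      by simp
    also have "real d * (\<tau>\<^sup>2 / 2 * 32 + 16 * \<tau>\<^sup>2 * (8 * m * \<bar>\<tau>\<bar>)) \<le> real d * (\<tau>\<^sup>2 / 2 * 32 + 16 * \<tau>\<^sup>2 * 1)"
      using small by (intro mult_left_mono add_left_mono) auto
    also have "\<dots> = c" by (simp add: c_def)
    finally show ?thesis .
  qed
  \<comment> \<open>The number of edges is the second moment with all coefficients 1.\<close>
  have card_E: "real (card E) \<le> m\<^sup>2 / 2"
  proof -
    have "real (card E) = rad V (\<lambda>x. (\<Sum>e\<in>E. 1 * of_real (chi e x)) ^ 2)"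
      using rad_square_sum[of V E "\<lambda>_. 1::real"] V E by simp
    also have "\<dots> = m * (m - 1) / 2"
      using rad_chi_sum_powers(2)[OF V(1,2)] by (simp add: chi_sum_def E_def m_def)
    finally show ?thesis using m by (simp add: power2_eq_square algebra_simps)
  qed
  have "cloud_exp d V (\<lambda>x. \<Prod>e\<in>E. Phi (\<tau> * (\<Sum>c<d. chi e (x c))))
      \<le> ?P (\<lambda>\<gamma>. norm (rad V (\<lambda>x. exp (W \<gamma> x))) ^ d)"
    unfolding W_def E_def by (rule cloud_exp_Phi_le_pexp[OF V(1,2)])
  also have "\<dots> \<le> ?P (\<lambda>\<gamma>. exp (7 * real d * (8 * m * \<tau>) ^ 4) * exp (f \<gamma>))"
    by (intro pexp_mono W_le)
  also have "\<dots> = exp (7 * real d * (8 * m * \<tau>) ^ 4) * ?P (\<lambda>\<gamma>. exp (f \<gamma>))"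
    by (rule pexp_mult_left)
  also have "?P (\<lambda>\<gamma>. exp (f \<gamma>)) \<le> exp (?P f + card E * c\<^sup>2)"
    using small freq_moments(1)
    by (intro pexp_exp_le E finite_freqs diff) (auto simp: freq_weight_def c_def)
  also have "?P f + card E * c\<^sup>2 \<le> ?P f + m\<^sup>2 / 2 * c\<^sup>2"
    using card_E by (intro add_left_mono mult_right_mono) auto
  also note Pf
  also have "m\<^sup>2 / 2 * c\<^sup>2 = 512 * m\<^sup>2 * (real d)\<^sup>2 * \<tau> ^ 4"
    by (simp add: c_def power_mult_distrib flip: power_mult)
  finally show ?thesis
    by (simp add: E_def add_ac flip: exp_add)
qed

section \<open>From clique probabilities to Ramsey numbers\<close>

text \<open>With independent edges the hypothesis bounds the expected number of forbidden
  monochromatic cliques. Some colouring has a total below 1, and each indicator is then below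
  1.\<close>

lemma exists_colouring:
  fixes q :: "'a set \<Rightarrow> real"
  assumes V: "finite V" and q: "\<And>e. 0 \<le> q e" "\<And>e. q e \<le> 1"
    and less: "(\<Sum>K\<in>nsets V l. \<Prod>e\<in>nsets K 2. q e) + (\<Sum>K\<in>nsets V k. \<Prod>e\<in>nsets K 2. 1 - q e) < 1"
  shows "\<exists>f\<in>nsets V 2 \<rightarrow> {..<2::nat}. (\<forall>K\<in>nsets V l. \<exists>e\<in>nsets K 2. f e \<noteq> 0) \<and> (\<forall>K\<in>nsets V k. \<exists>e\<in>nsets K 2. f e \<noteq> 1)"
proof -
  define w where "w e b = (if b = 0 then q e else 1 - q e)" for e and b :: nat
  define mc where "mc i K f = (\<Prod>e\<in>nsets K 2. if f e = i then 1 else 0 :: real)" for i K and f :: "'a set \<Rightarrow> nat"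
  interpret weights "{0, 1::nat}" w "nsets V 2"
    using V q by unfold_locales (auto simp: w_def finite_imp_finite_nsets)
  have mc_exp: "pexp {0, 1} w (nsets V 2) (mc i K) = (\<Prod>e\<in>nsets K 2. w e i)"
    if "K \<in> nsets V j" "i \<in> {0, 1}" for K i j
  proof -
    have "nsets K 2 \<subseteq> nsets V 2" using that by (intro nsets_mono) (auto simp: nsets_def)
    from pexp_prod_subset[OF this, of "\<lambda>_ b. if b = i then 1 else (0::real)"] that(2)
    show ?thesis unfolding mc_def[abs_def] by (auto intro!: prod.cong)
  qed
  have exp_eq: "pexp {0, 1} w (nsets V 2) (\<lambda>f. (\<Sum>K\<in>nsets V l. mc 0 K f) + (\<Sum>K\<in>nsets V k. mc 1 K f))
      = (\<Sum>K\<in>nsets V l. \<Prod>e\<in>nsets K 2. q e) + (\<Sum>K\<in>nsets V k. \<Prod>e\<in>nsets K 2. 1 - q e)"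
    unfolding pexp_add pexp_sum
    by (intro arg_cong2[where f = "(+)"] sum.cong refl; subst mc_exp) (auto simp: w_def)
  obtain f where f: "f \<in> Pi\<^sub>E (nsets V 2) (\<lambda>_. {0, 1})"
      "(\<Sum>K\<in>nsets V l. mc 0 K f) + (\<Sum>K\<in>nsets V k. mc 1 K f) < 1"
    using pexp_less_imp_ex[OF less[folded exp_eq]] by blast
  have nonneg: "0 \<le> mc i K f" for i K by (auto simp: mc_def intro!: prod_nonneg)
  have small: "mc i K f < 1" if "K \<in> nsets V j" "(j, i) = (l, 0) \<or> (j, i) = (k, 1)" for i j K
  proof -
    have "mc i K f \<le> (\<Sum>K\<in>nsets V j. mc i K f)"
      using that V nonneg by (intro member_le_sum) (auto simp: finite_imp_finite_nsets)
    also have "\<dots> \<le> (\<Sum>K\<in>nsets V l. mc 0 K f) + (\<Sum>K\<in>nsets V k. mc 1 K f)"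
      using that nonneg by (auto intro!: sum_nonneg)
    finally show ?thesis using f(2) by simp
  qed
  have not_mc: "\<exists>e\<in>nsets K 2. f e \<noteq> i" if "mc i K f < 1" for i K
  proof (rule ccontr)
    assume "\<not> ?thesis"
    then have "mc i K f = 1" unfolding mc_def by (intro prod.neutral) auto
    then show False using that by simp
  qed
  show ?thesis
  proof (intro bexI[of _ f] conjI ballI not_mc)
    show "f \<in> nsets V 2 \<rightarrow> {..<2}" using f(1) by (auto simp: PiE_iff Pi_iff less_2_cases_iff)
  qed (auto intro: small)
qed

text \<open>The first moment is taken in two stages: some choice of sign vectors makes the
  conditional expected number of bad cliques less than 1, and for it the edges can be coloured
  independently.\<close>

lemma less_ramsey_number:
  fixes p \<sigma> :: real and l k n d :: nat
  defines "r \<equiv> p / (1 - p)"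
  defines "bnd \<equiv> \<lambda>m \<tau>. exp (real d * \<tau> ^ 3 * (m * (m - 1) * (m - 2)) / 6 + 7 * real d * (8 * m * \<tau>) ^ 4 + 512 * m\<^sup>2 * (real d)\<^sup>2 * \<tau> ^ 4)"
  assumes p: "0 < p" "p < 1" and \<sigma>: "0 < \<sigma>" and lk: "0 < l" "0 < k"
    and small: "8 * real l * \<sigma> \<le> 1" "8 * real k * (r * \<sigma>) \<le> 1" "32 * real d * \<sigma>\<^sup>2 \<le> 1" "32 * real d * (r * \<sigma>)\<^sup>2 \<le> 1"
    and less: "real n ^ l * (p ^ (l choose 2) * bnd (real l) (- \<sigma>)) + real n ^ k * ((1 - p) ^ (k choose 2) * bnd (real k) (r * \<sigma>)) < 1"
  shows "n < ramsey_number l k"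
proof -
  define V where "V = {..<n}"
  define s where "s e x = (\<Sum>c<d. chi e (x c))" for e :: "nat set" and x :: "nat \<Rightarrow> nat \<Rightarrow> real"
  \<comment> \<open>Clipping does no harm: \<open>Phi\<close> dominates the positive part of
    \<open>1 + u\<close>, for red and blue alike.\<close>
  define q where "q x e = max 0 (min 1 (p * (1 + (- \<sigma>) * s e x)))" for x e
  have V: "finite V" "card V = n" by (auto simp: V_def)
  have q01: "0 \<le> q x e" "q x e \<le> 1" for x e by (auto simp: q_def)
  have q_le: "q x e \<le> p * Phi ((- \<sigma>) * s e x)" for x e
  proof -
    have "q x e \<le> max 0 (p * (1 + (- \<sigma>) * s e x))" by (auto simp: q_def)
    also have "\<dots> = p * max 0 (1 + (- \<sigma>) * s e x)"
      using p by (simp add: max_mult_distrib_left)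
    also have "\<dots> \<le> p * Phi ((- \<sigma>) * s e x)"
      using p by (intro mult_left_mono Phi_ge_tangent) auto
    finally show ?thesis .
  qed
  have q_ge: "1 - q x e \<le> (1 - p) * Phi (r * \<sigma> * s e x)" for x e
  proof -
    have "1 - q x e \<le> max 0 (1 - p * (1 + (- \<sigma>) * s e x))" by (auto simp: q_def)
    \<comment> \<open>The tilt of the blue probability has the opposite sign and is scaled by
      \<open>r = p / (1 - p)\<close>.\<close>
    also have "1 - p * (1 + (- \<sigma>) * s e x) = (1 - p) * (1 + r * \<sigma> * s e x)"
      using p by (simp add: r_def field_simps)
    also have "max 0 \<dots> = (1 - p) * max 0 (1 + r * \<sigma> * s e x)"
      using p by (simp add: max_mult_distrib_left)
    also have "\<dots> \<le> (1 - p) * Phi (r * \<sigma> * s e x)"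
      using p by (intro mult_left_mono Phi_ge_tangent) auto
    finally show ?thesis .
  qed
  interpret cloud: weights "Pi\<^sub>E V (\<lambda>_. {-1, 1::real})" "\<lambda>_ _. (1/2) ^ card V" "{..<d}"
    by (intro cloud_weights V)
  \<comment> \<open>A union bound over the vertex sets of size \<open>m\<close>, stated once for
    both colours.\<close>
  have clique: "cloud_exp d V (\<lambda>x. \<Sum>K\<in>nsets V m. \<Prod>e\<in>nsets K 2. h x e) \<le> real n ^ m * (a ^ (m choose 2) * bnd (real m) \<tau>)"
    if h: "\<And>x e. 0 \<le> h x e" "\<And>x e. h x e \<le> a * Phi (\<tau> * s e x)" and a: "0 \<le> a"
      and m: "0 < m" "8 * real m * \<bar>\<tau>\<bar> \<le> 1" "32 * real d * \<tau>\<^sup>2 \<le> 1" for h a \<tau> m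
  proof -
    have "cloud_exp d V (\<lambda>x. \<Prod>e\<in>nsets K 2. h x e) \<le> a ^ (m choose 2) * bnd (real m) \<tau>"
      if K: "K \<in> nsets V m" for K
    proof -
      have K': "K \<subseteq> V" "K \<noteq> {}" "finite K" "card K = m" using K m by (auto simp: nsets_def)
      have "cloud_exp d V (\<lambda>x. \<Prod>e\<in>nsets K 2. h x e) \<le> cloud_exp d V (\<lambda>x. \<Prod>e\<in>nsets K 2. a * Phi (\<tau> * s e x))"
        unfolding cloud_exp_def using h by (intro cloud.pexp_mono prod_mono) auto
      also have "\<dots> = a ^ (m choose 2) * cloud_exp d V (\<lambda>x. \<Prod>e\<in>nsets K 2. Phi (\<tau> * (\<Sum>c<d. chi e (x c))))"
        using K' unfolding cloud_exp_def s_def by (simp add: prod.distrib pexp_mult_left card_nsets)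
      also have "\<dots> \<le> a ^ (m choose 2) * bnd (real m) \<tau>"
        using cloud_exp_Phi_le[OF V(1) K'(1,2), of \<tau> d] a m K' by (intro mult_left_mono) (auto simp: bnd_def)
      finally show ?thesis .
    qed
    then have "cloud_exp d V (\<lambda>x. \<Sum>K\<in>nsets V m. \<Prod>e\<in>nsets K 2. h x e) \<le> (\<Sum>K\<in>nsets V m. a ^ (m choose 2) * bnd (real m) \<tau>)"
      unfolding cloud_exp_def pexp_sum by (intro sum_mono)
    also have "\<dots> = real (n choose m) * (a ^ (m choose 2) * bnd (real m) \<tau>)"
      using V by (simp add: card_nsets)
    also have "real (n choose m) \<le> real n ^ m"
    proof (cases "m \<le> n")
      case True
      then show ?thesis using binomial_le_pow[OF True] by (metis of_nat_le_iff of_nat_power)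
    qed (simp add: binomial_eq_0)
    then have "real (n choose m) * (a ^ (m choose 2) * bnd (real m) \<tau>) \<le> real n ^ m * (a ^ (m choose 2) * bnd (real m) \<tau>)"
      using a by (intro mult_right_mono) (auto simp: bnd_def)
    finally show ?thesis .
  qed
  have "0 < r" using p by (simp add: r_def)
  have "cloud_exp d V (\<lambda>x. (\<Sum>K\<in>nsets V l. \<Prod>e\<in>nsets K 2. q x e) + (\<Sum>K\<in>nsets V k. \<Prod>e\<in>nsets K 2. 1 - q x e))
      = cloud_exp d V (\<lambda>x. \<Sum>K\<in>nsets V l. \<Prod>e\<in>nsets K 2. q x e) + cloud_exp d V (\<lambda>x. \<Sum>K\<in>nsets V k. \<Prod>e\<in>nsets K 2. 1 - q x e)"
    unfolding cloud_exp_def by (rule pexp_add)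
  also have "\<dots> \<le> real n ^ l * (p ^ (l choose 2) * bnd (real l) (- \<sigma>)) + real n ^ k * ((1 - p) ^ (k choose 2) * bnd (real k) (r * \<sigma>))"
    using p \<sigma> lk small \<open>0 < r\<close> q01 by (intro add_mono clique q_le q_ge) auto
  also note less
  finally obtain x where x: "(\<Sum>K\<in>nsets V l. \<Prod>e\<in>nsets K 2. q x e) + (\<Sum>K\<in>nsets V k. \<Prod>e\<in>nsets K 2. 1 - q x e) < 1"
    unfolding cloud_exp_def by (drule_tac cloud.pexp_less_imp_ex) blast
  from exists_colouring[OF V(1) q01 x]
  obtain f where f: "f \<in> nsets V 2 \<rightarrow> {..<2::nat}" "\<forall>K\<in>nsets V l. \<exists>e\<in>nsets K 2. f e \<noteq> 0"
      "\<forall>K\<in>nsets V k. \<exists>e\<in>nsets K 2. f e \<noteq> 1" by blast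
  have "\<not> partn_lst V [l, k] 2"
  proof
    assume "partn_lst V [l, k] 2"
    then obtain i K where iK: "i < Suc (Suc 0)" "K \<in> nsets V ([l, k] ! i)" "f ` nsets K 2 \<subseteq> {i}"
      by (rule partn_lstE[OF _ f(1)]) auto
    then have "\<exists>e\<in>nsets K 2. f e \<noteq> i"
      using f(2,3) by (cases i) auto
    with iK(3) show False by auto
  qed
  then show ?thesis
    using partn_lst_greater_resource[OF ramsey_number_props(2), of l k n]
    unfolding V_def by (metis linorder_not_le)
qed

section \<open>Choice of the parameters\<close>

text \<open>The upper bound lets the red gain, and the lower bound the blue gain, survive the shift
  of the density by \<open_t>.\<close>

lemma shift_choice:
  fixes p C :: real
  assumes C: "C > 1" and p: "0 < p" "p < 1/2" "C = ln p / ln (1 - p)"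
  obtains t where "C * p ^ 3 / (3 * (1 - p)\<^sup>2) < t" "t < p / 3"
proof -
  have "ln (1 - p) < 0" using p by simp
  then have "ln p = C * ln (1 - p)" using p by (simp add: field_simps)
  then have "C * p\<^sup>2 * (- ln (1 - p)) = p\<^sup>2 * (- ln p)" by simp
  also have "\<dots> < (1 - p)\<^sup>2 * (- ln (1 - p))"
    by (rule square_mult_ln_less[OF p(1,2)])
  finally have "C * p\<^sup>2 * (- ln (1 - p)) < (1 - p)\<^sup>2 * (- ln (1 - p))" .
  then have "C * p\<^sup>2 < (1 - p)\<^sup>2"
    using \<open>ln (1 - p) < 0\<close> by (metis mult_less_cancel_right_pos neg_0_less_iff_less)
  then have "C * p\<^sup>2 / (1 - p)\<^sup>2 < 1"
    using p(1,2) by (simp add: divide_less_eq)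
  then have "p / 3 * (C * p\<^sup>2 / (1 - p)\<^sup>2) < p / 3 * 1"
    using p(1) by (intro mult_strict_left_mono) auto
  also have "p / 3 * (C * p\<^sup>2 / (1 - p)\<^sup>2) = C * p ^ 3 / (3 * (1 - p)\<^sup>2)"
    by (simp add: power3_eq_cube power2_eq_square)
  finally have "C * p ^ 3 / (3 * (1 - p)\<^sup>2) < p / 3" by simp
  then show ?thesis using dense that by blast
qed

lemma tendsto_floor_over:
  fixes C :: real assumes "C > 0"
  shows "(\<lambda>l::nat. real (nat \<lfloor>C * real l\<rfloor>) / real l) \<longlonglongrightarrow> C"
proof (rule tendsto_sandwich[of "\<lambda>l. C - 1 / real l" _ _ "\<lambda>_. C"])
  have fl: "C * real l - 1 \<le> real (nat \<lfloor>C * real l\<rfloor>)" "real (nat \<lfloor>C * real l\<rfloor>) \<le> C * real l" for l :: nat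
    using assms by (auto simp: of_nat_nat)
  show "\<forall>\<^sub>F l in sequentially. C - 1 / real l \<le> real (nat \<lfloor>C * real l\<rfloor>) / real l"
    using eventually_gt_at_top[of 0]
  proof eventually_elim
    case (elim l)
    then have "C - 1 / real l = (C * real l - 1) / real l" by (simp add: field_simps)
    also have "\<dots> \<le> real (nat \<lfloor>C * real l\<rfloor>) / real l"
      using fl(1) by (intro divide_right_mono) auto
    finally show ?case .
  qed
  show "\<forall>\<^sub>F l in sequentially. real (nat \<lfloor>C * real l\<rfloor>) / real l \<le> C"
    using eventually_gt_at_top[of 0] by eventually_elim (use fl in \<open>simp add: field_simps\<close>)
  show "(\<lambda>l. C - 1 / real l) \<longlonglongrightarrow> C" by real_asymp
qed auto

lemma real_choose_two: "real (n choose 2) = real n * (real n - 1) / 2"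
  by (induction n) (auto simp: numeral_2_eq_2 field_simps)

text \<open>The density is shifted to \<open>p + t * \<eta> ^ 3\<close>. All terms of order
  \<open>\<eta> ^ 3\<close> then have negative total in both colours, and a small \<eta> absorbs the
  fourth-order errors. The constants come from \<open>28672 = 7 * 8 ^ 4\<close> and
  \<open>29184 = 28672 + 512\<close>.\<close>

lemma rate_choice:
  fixes p C :: real
  assumes C: "C > 1" and p: "0 < p" "p < 1/2" "C = ln p / ln (1 - p)"
  obtains \<eta> q where "0 < \<eta>" "8 * C * \<eta> \<le> 1" "0 < q" "q < 1/2"
    "ln q / 2 - \<eta> ^ 3 / 6 + 29184 * \<eta> ^ 4 < ln p / 2"
    "C\<^sup>2 / 2 * ln (1 - q) + (q / (1 - q) * \<eta>) ^ 3 * C ^ 3 / 6 + (q / (1 - q) * \<eta>) ^ 4 * (28672 * C ^ 4 + 512 * C\<^sup>2) < C * (ln p / 2)"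
proof -
  obtain t where t: "C * p ^ 3 / (3 * (1 - p)\<^sup>2) < t" "t < p / 3"
    using shift_choice[OF assms] by blast
  have "0 < C * p ^ 3 / (3 * (1 - p)\<^sup>2)" using C p(1,2) by simp
  then have "0 < t" using t by linarith
  define q where "q \<eta> = p + t * \<eta> ^ 3" for \<eta>
  define r where "r \<eta> = q \<eta> / (1 - q \<eta>)" for \<eta>
  have q_lim: "(q \<longlongrightarrow> p) (at_right 0)"
    unfolding q_def by (auto intro!: tendsto_eq_intros)
  have r_lim: "(r \<longlongrightarrow> p / (1 - p)) (at_right 0)"
    unfolding r_def using p(1,2) by (auto intro!: tendsto_eq_intros q_lim)
  \<comment> \<open>This is the red excess divided by \<open>\<eta> ^ 3\<close>, with the logarithm
    replaced by its tangent at \<open>p\<close>; the blue excess is treated likewise.\<close>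
  have "((\<lambda>\<eta>. t / (2 * p) - 1 / 6 + 29184 * \<eta>) \<longlongrightarrow> t / (2 * p) - 1 / 6 + 29184 * 0) (at_right 0)"
    by (intro tendsto_intros)
  moreover have "t / (2 * p) - 1 / 6 + 29184 * 0 < 0"
    using t p(1,2) by (simp add: field_simps)
  ultimately have ev_red: "\<forall>\<^sub>F \<eta> in at_right 0. t / (2 * p) - 1 / 6 + 29184 * \<eta> < 0"
    by (rule order_tendstoD)
  have "((\<lambda>\<eta>. - (C\<^sup>2 / 2 * (t / (1 - p))) + r \<eta> ^ 3 * C ^ 3 / 6 + \<eta> * (r \<eta> ^ 4 * (28672 * C ^ 4 + 512 * C\<^sup>2)))
      \<longlongrightarrow> - (C\<^sup>2 / 2 * (t / (1 - p))) + (p / (1 - p)) ^ 3 * C ^ 3 / 6 + 0 * ((p / (1 - p)) ^ 4 * (28672 * C ^ 4 + 512 * C\<^sup>2))) (at_right 0)"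
    by (intro tendsto_intros r_lim) auto
  moreover have "- (C\<^sup>2 / 2 * (t / (1 - p))) + (p / (1 - p)) ^ 3 * C ^ 3 / 6 + 0 * ((p / (1 - p)) ^ 4 * (28672 * C ^ 4 + 512 * C\<^sup>2)) < 0"
  proof -
    have "(p / (1 - p)) ^ 3 * C ^ 3 / 6 = C\<^sup>2 / (2 * (1 - p)) * (C * p ^ 3 / (3 * (1 - p)\<^sup>2))"
      by (simp add: power_divide power2_eq_square power3_eq_cube mult_ac del: right_diff_distrib_numeral) (simp add: algebra_simps)
    also have "\<dots> < C\<^sup>2 / (2 * (1 - p)) * t"
      using t C p(1,2) by (intro mult_strict_left_mono) auto
    finally show ?thesis by simp
  qed
  ultimately have ev_blue: "\<forall>\<^sub>F \<eta> in at_right 0. - (C\<^sup>2 / 2 * (t / (1 - p))) + r \<eta> ^ 3 * C ^ 3 / 6 + \<eta> * (r \<eta> ^ 4 * (28672 * C ^ 4 + 512 * C\<^sup>2)) < 0"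
    by (rule order_tendstoD)
  have ev_q: "\<forall>\<^sub>F \<eta> in at_right 0. q \<eta> < 1/2"
    using q_lim p(2) by (rule order_tendstoD)
  have ev_small: "\<forall>\<^sub>F \<eta> in at_right 0. \<eta> \<in> {0<..<1 / (8 * C)}"
    using C by (intro eventually_at_right_real) auto
  from eventually_happens'[OF _ eventually_conj[OF ev_red eventually_conj[OF ev_blue eventually_conj[OF ev_q ev_small]]]]
  obtain \<eta> where \<eta>: "t / (2 * p) - 1 / 6 + 29184 * \<eta> < 0"
      "- (C\<^sup>2 / 2 * (t / (1 - p))) + r \<eta> ^ 3 * C ^ 3 / 6 + \<eta> * (r \<eta> ^ 4 * (28672 * C ^ 4 + 512 * C\<^sup>2)) < 0"
      "q \<eta> < 1/2" "0 < \<eta>" "\<eta> < 1 / (8 * C)"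
    by auto
  have "0 < t * \<eta> ^ 3" using \<open>0 < t\<close> \<eta> by simp
  have "ln (q \<eta>) - ln p \<le> (q \<eta> - p) / p"
    using p(1,2) \<open>0 < t * \<eta> ^ 3\<close> by (intro ln_diff_le) (auto simp: q_def)
  then have "ln (q \<eta>) / 2 - \<eta> ^ 3 / 6 + 29184 * \<eta> ^ 4 \<le> ln p / 2 + (t * \<eta> ^ 3 / p / 2 - \<eta> ^ 3 / 6 + 29184 * \<eta> ^ 4)"
    by (simp add: q_def)
  also have "t * \<eta> ^ 3 / p / 2 - \<eta> ^ 3 / 6 + 29184 * \<eta> ^ 4 = \<eta> ^ 3 * (t / (2 * p) - 1 / 6 + 29184 * \<eta>)"
    by (simp add: algebra_simps eval_nat_numeral)
  also have "\<dots> < 0" using \<eta> by (intro mult_pos_neg) auto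
  finally have red: "ln (q \<eta>) / 2 - \<eta> ^ 3 / 6 + 29184 * \<eta> ^ 4 < ln p / 2" by simp
  have "ln (1 - p) < 0" using p by simp
  then have lnp: "ln p = C * ln (1 - p)" using p by (simp add: field_simps)
  have "ln (1 - q \<eta>) - ln (1 - p) \<le> ((1 - q \<eta>) - (1 - p)) / (1 - p)"
    using p(1,2) \<eta> by (intro ln_diff_le) auto
  also have "\<dots> = - (t * \<eta> ^ 3 / (1 - p))"
    using p(1,2) by (simp add: q_def divide_simps)
  finally have "ln (1 - q \<eta>) \<le> ln (1 - p) - t * \<eta> ^ 3 / (1 - p)" by simp
  then have "C\<^sup>2 / 2 * ln (1 - q \<eta>) \<le> C\<^sup>2 / 2 * (ln (1 - p) - t * \<eta> ^ 3 / (1 - p))"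
    by (rule mult_left_mono) simp
  then have "C\<^sup>2 / 2 * ln (1 - q \<eta>) + (r \<eta> * \<eta>) ^ 3 * C ^ 3 / 6 + (r \<eta> * \<eta>) ^ 4 * (28672 * C ^ 4 + 512 * C\<^sup>2)
      \<le> C\<^sup>2 / 2 * (ln (1 - p) - t * \<eta> ^ 3 / (1 - p)) + (r \<eta> * \<eta>) ^ 3 * C ^ 3 / 6 + (r \<eta> * \<eta>) ^ 4 * (28672 * C ^ 4 + 512 * C\<^sup>2)"
    by simp
  also have "\<dots> = C * (ln p / 2) + \<eta> ^ 3 * (- (C\<^sup>2 / 2 * (t / (1 - p))) + r \<eta> ^ 3 * C ^ 3 / 6 + \<eta> * (r \<eta> ^ 4 * (28672 * C ^ 4 + 512 * C\<^sup>2)))"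
    unfolding lnp power_mult_distrib by (simp add: algebra_simps eval_nat_numeral)
  also have "\<dots> < C * (ln p / 2) + 0"
    using \<eta> by (intro add_strict_left_mono mult_pos_neg) auto
  finally have blue: "C\<^sup>2 / 2 * ln (1 - q \<eta>) + (r \<eta> * \<eta>) ^ 3 * C ^ 3 / 6 + (r \<eta> * \<eta>) ^ 4 * (28672 * C ^ 4 + 512 * C\<^sup>2) < C * (ln p / 2)"
    by simp
  show ?thesis
    using \<eta> red blue C p(1,2) \<open>0 < t * \<eta> ^ 3\<close>
    by (intro that[of \<eta> "q \<eta>"]) (auto simp: r_def field_simps q_def)
qed

text \<open>The logarithm, divided by \<open>l\<^sup>2\<close>, of the bound for cliques on
  \<open>m = y * l\<close> vertices, with \<open>h = 1 / l\<close>, \<open>exp (L * l)\<close>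
  vertices in all, edge density \<open>a\<close> and tilt \<open>b / l\<close>.\<close>

definition rate :: "real \<Rightarrow> real \<Rightarrow> real \<Rightarrow> real \<Rightarrow> real \<Rightarrow> real" where
  "rate L a b y h = y * L + y * (y - h) / 2 * ln a + (b ^ 3 * (y * (y - h) * (y - 2 * h)) / 6 + b ^ 4 * (28672 * y ^ 4 + 512 * y\<^sup>2))"

lemma tendsto_rate:
  assumes "y \<longlonglongrightarrow> C" "h \<longlonglongrightarrow> 0"
  shows "(\<lambda>l. rate L a b (y l) (h l)) \<longlonglongrightarrow> rate L a b C 0"
  unfolding rate_def by (intro tendsto_intros assms) auto

text \<open>With tilt of order 1/l and dimension \<open>l\<^sup>2\<close>, every term of the
  exponent scales as \<open>l\<^sup>2\<close>.\<close>

lemma clique_bound_le_rate: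
  fixes a b L :: real and l m n :: nat
  assumes "0 < l" "0 < a" "real n \<le> exp L ^ l"
  defines "\<tau> \<equiv> b / l" and "d \<equiv> l\<^sup>2"
  shows "real n ^ m * (a ^ (m choose 2) * exp (real d * \<tau> ^ 3 * (real m * (real m - 1) * (real m - 2)) / 6
      + 7 * real d * (8 * real m * \<tau>) ^ 4 + 512 * (real m)\<^sup>2 * (real d)\<^sup>2 * \<tau> ^ 4))
    \<le> exp ((real l)\<^sup>2 * rate L a b (real m / real l) (1 / real l))"
proof -
  define x where "x = real l"
  define y where "y = real m / x"
  have x: "0 < x" using assms by (simp add: x_def)
  have m: "real m = x * y" using x by (simp add: y_def)
  have "real n ^ m \<le> (exp L ^ l) ^ m"
    using assms by (intro power_mono) auto
  also have "\<dots> = exp (x\<^sup>2 * (y * L))"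
    using m by (simp add: x_def power2_eq_square mult_ac flip: exp_of_nat_mult)
  finally have n: "real n ^ m \<le> exp (x\<^sup>2 * (y * L))" .
  have "a ^ (m choose 2) = exp (real (m choose 2) * ln a)"
    using assms by (simp add: exp_of_nat_mult)
  also have "real (m choose 2) * ln a = x\<^sup>2 * (y * (y - 1 / x) / 2 * ln a)"
    using x unfolding real_choose_two m by (simp add: field_simps power2_eq_square)
  finally have a: "a ^ (m choose 2) = exp (x\<^sup>2 * (y * (y - 1 / x) / 2 * ln a))" .
  have "real d * \<tau> ^ 3 * (real m * (real m - 1) * (real m - 2)) / 6 = x\<^sup>2 * (b ^ 3 * (y * (y - 1 / x) * (y - 2 * (1 / x))) / 6)"
  proof -
    have "real m - 1 = x * (y - 1 / x)" "real m - 2 = x * (y - 2 * (1 / x))"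
      using x m by (auto simp: field_simps)
    then show ?thesis
      using x unfolding \<tau>_def d_def m by (simp add: x_def[symmetric] power_divide power2_eq_square power3_eq_cube)
  qed
  moreover have "7 * real d * (8 * real m * \<tau>) ^ 4 = x\<^sup>2 * (b ^ 4 * (28672 * y ^ 4))"
  proof -
    have "real m * \<tau> = b * y" using x by (simp add: m \<tau>_def x_def[symmetric])
    then have "(8 * real m * \<tau>) ^ 4 = 4096 * (b ^ 4 * y ^ 4)"
      by (simp add: mult.assoc power_mult_distrib)
    then show ?thesis by (simp add: d_def x_def)
  qed
  moreover have "512 * (real m)\<^sup>2 * (real d)\<^sup>2 * \<tau> ^ 4 = x\<^sup>2 * (b ^ 4 * (512 * y\<^sup>2))"
    using x unfolding \<tau>_def d_def m
    by (simp add: x_def[symmetric] power_divide power_mult_distrib flip: power_mult)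
  ultimately have e: "real d * \<tau> ^ 3 * (real m * (real m - 1) * (real m - 2)) / 6
      + 7 * real d * (8 * real m * \<tau>) ^ 4 + 512 * (real m)\<^sup>2 * (real d)\<^sup>2 * \<tau> ^ 4
      = x\<^sup>2 * (b ^ 3 * (y * (y - 1 / x) * (y - 2 * (1 / x))) / 6 + b ^ 4 * (28672 * y ^ 4 + 512 * y\<^sup>2))"
    by (simp only: distrib_left add.assoc)
  have "real n ^ m * (a ^ (m choose 2) * exp (real d * \<tau> ^ 3 * (real m * (real m - 1) * (real m - 2)) / 6
      + 7 * real d * (8 * real m * \<tau>) ^ 4 + 512 * (real m)\<^sup>2 * (real d)\<^sup>2 * \<tau> ^ 4))
    \<le> exp (x\<^sup>2 * (y * L)) * (exp (x\<^sup>2 * (y * (y - 1 / x) / 2 * ln a)) * 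
      exp (x\<^sup>2 * (b ^ 3 * (y * (y - 1 / x) * (y - 2 * (1 / x))) / 6 + b ^ 4 * (28672 * y ^ 4 + 512 * y\<^sup>2))))"
    unfolding a e by (intro mult_right_mono n) auto
  also have "\<dots> = exp (x\<^sup>2 * rate L a b y (1 / x))"
    unfolding rate_def exp_add[symmetric] by (simp only: distrib_left add.assoc)
  finally show ?thesis by (simp only: y_def x_def)
qed

theorem theorem1p1:
  fixes C :: real
  assumes "C > 1"
  shows "\<exists>\<epsilon>>0. \<exists>l0>0. \<forall>l\<ge>l0.
           real (ramsey_number l (nat \<lfloor>C * real l\<rfloor>)) \<ge> (M_val C + \<epsilon>) ^ l"
proof -
  note p = p_val_props[OF assms]
  define M where "M = M_val C"
  have M: "0 < M" "ln M = - (ln (p_val C) / 2)"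
    using p by (auto simp: M_def M_val_def ln_powr)
  obtain \<eta> q where \<eta>: "0 < \<eta>" "8 * C * \<eta> \<le> 1" and q: "0 < q" "q < 1/2"
    and red: "ln q / 2 - \<eta> ^ 3 / 6 + 29184 * \<eta> ^ 4 < ln (p_val C) / 2"
    and blue: "C\<^sup>2 / 2 * ln (1 - q) + (q / (1 - q) * \<eta>) ^ 3 * C ^ 3 / 6
        + (q / (1 - q) * \<eta>) ^ 4 * (28672 * C ^ 4 + 512 * C\<^sup>2) < C * (ln (p_val C) / 2)"
    by (rule rate_choice[OF assms p])
  define r where "r = q / (1 - q)"
  have r: "0 < r" "r < 1" using q by (auto simp: r_def)
  have rate0: "rate (ln M) q (- \<eta>) 1 0 < 0" "rate (ln M) (1 - q) (r * \<eta>) C 0 < 0"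
    using red blue unfolding rate_def M(2) r_def
    by (auto simp: power2_eq_square power3_eq_cube algebra_simps)
  \<comment> \<open>Both limiting rates at \<open>M\<close> are strictly negative; by continuity
    this persists at \<open>M + \<epsilon>\<close>, which yields the \<epsilon> of the
    theorem.\<close>
  have lim: "((\<lambda>\<epsilon>. rate (ln (M + \<epsilon>)) a b y h) \<longlongrightarrow> rate (ln M) a b y h) (at_right 0)" for a b y h
    unfolding rate_def using M by (auto intro!: tendsto_eq_intros)
  have "\<forall>\<^sub>F \<epsilon> in at_right 0. \<epsilon> \<in> {0<..<1::real}"
    by (rule eventually_at_right_real) simp
  from eventually_happens'[OF _ eventually_conj[OF this eventually_conj[OF order_tendstoD(2)[OF lim rate0(1)] order_tendstoD(2)[OF lim rate0(2)]]]]
  obtain \<epsilon> where \<epsilon>: "0 < \<epsilon>" and rate_neg: "rate (ln (M + \<epsilon>)) q (- \<eta>) 1 0 < 0" "rate (ln (M + \<epsilon>)) (1 - q) (r * \<eta>) C 0 < 0"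
    by auto
  define L where "L = ln (M + \<epsilon>)"
  have L: "exp L = M + \<epsilon>" using M \<epsilon> by (simp add: L_def)
  define k where "k l = nat \<lfloor>C * real l\<rfloor>" for l
  have k_lim: "(\<lambda>l. real (k l) / real l) \<longlonglongrightarrow> C"
    unfolding k_def using assms by (intro tendsto_floor_over) simp
  have sq: "LIM l sequentially. (real l)\<^sup>2 :> at_top" by real_asymp
  have inv: "(\<lambda>l. 1 / real l) \<longlonglongrightarrow> 0" by real_asymp
  have small: "(\<lambda>l. exp ((real l)\<^sup>2 * rate L a b (y l) (1 / real l))) \<longlonglongrightarrow> 0"
    if "y \<longlonglongrightarrow> c" "rate L a b c 0 < 0" for a b c y
  proof -
    \<comment> \<open>The rate tends to a negative limit, so \<open>l\<^sup>2\<close> times it tends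
      to minus infinity and both expected counts vanish.\<close>
    have "LIM l sequentially. rate L a b (y l) (1 / real l) * (real l)\<^sup>2 :> at_bot"
      by (rule filterlim_tendsto_neg_mult_at_bot[OF tendsto_rate[OF that(1) inv] that(2) sq])
    then show ?thesis
      by (subst mult.commute) (rule filterlim_compose[OF exp_at_bot])
  qed
  have "(\<lambda>l. exp ((real l)\<^sup>2 * rate L q (- \<eta>) 1 (1 / real l)) + exp ((real l)\<^sup>2 * rate L (1 - q) (r * \<eta>) (real (k l) / real l) (1 / real l))) \<longlonglongrightarrow> 0 + 0"
    using rate_neg unfolding L_def[symmetric]
    by (intro tendsto_add small[OF tendsto_const] small[OF k_lim])
  then have "\<forall>\<^sub>F l in sequentially. exp ((real l)\<^sup>2 * rate L q (- \<eta>) 1 (1 / real l)) + exp ((real l)\<^sup>2 * rate L (1 - q) (r * \<eta>) (real (k l) / real l) (1 / real l)) < 1"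
    by (rule order_tendstoD) simp
  then obtain l0 where l0: "exp ((real l)\<^sup>2 * rate L q (- \<eta>) 1 (1 / real l)) + exp ((real l)\<^sup>2 * rate L (1 - q) (r * \<eta>) (real (k l) / real l) (1 / real l)) < 1"
    if "l \<ge> l0" for l
    by (auto simp: eventually_sequentially)
  have main: "real (ramsey_number l (k l)) \<ge> (M + \<epsilon>) ^ l" if l: "l \<ge> max l0 1" for l
  proof -
    \<comment> \<open>Rounding down is harmless: \<open>n < ramsey_number l (k l)\<close> gives at
      least \<open>n + 1\<close>, which exceeds \<open>(M + \<epsilon>) ^ l\<close>.\<close>
    define n where "n = nat \<lfloor>(M + \<epsilon>) ^ l\<rfloor>"
    have n: "real n \<le> exp L ^ l" "(M + \<epsilon>) ^ l < real n + 1"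
      unfolding n_def L using M \<epsilon> by (auto simp: of_nat_nat)
    have l1: "1 \<le> real l" using l by simp
    have kl: "real (k l) \<le> C * real l" "0 < k l"
    proof -
      show "real (k l) \<le> C * real l" using assms by (auto simp: k_def of_nat_nat)
      have "1 * 1 \<le> C * real l" using assms l1 by (intro mult_mono) auto
      then show "0 < k l" by (simp add: k_def)
    qed
    \<comment> \<open>Together with \<open>r < 1\<close> this gives the smallness conditions of
      \<open>less_ramsey_number\<close>; the one on \<open>k l\<close> relies on
      \<open>8 * C * \<eta> \<le> 1\<close>.\<close>
    have "\<eta> \<le> 1/8" using \<eta> assms mult_right_mono[of 1 C \<eta>] by linarith
    then have \<eta>2: "\<eta>\<^sup>2 \<le> 1/32" using \<eta> power_mono[of \<eta> "1/8" 2] by (simp add: power2_eq_square)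
    have r2: "r\<^sup>2 \<le> 1" using r by (simp add: power_le_one)
    have "n < ramsey_number l (k l)"
    proof (rule less_ramsey_number[of q "\<eta> / l" l "k l" "l\<^sup>2" n, folded r_def])
      show "8 * real l * (\<eta> / real l) \<le> 1" using \<open>\<eta> \<le> 1/8\<close> l by simp
      show "8 * real (k l) * (r * (\<eta> / real l)) \<le> 1"
      proof -
        have "8 * real (k l) * (r * (\<eta> / real l)) = 8 * (real (k l) / real l) * r * \<eta>" by simp
        also have "\<dots> \<le> 8 * C * 1 * \<eta>"
          using kl l1 r \<eta> assms by (intro mult_mono) (auto simp: divide_le_eq)
        finally show ?thesis using \<eta> by simp
      qed
      show "32 * real (l\<^sup>2) * (\<eta> / real l)\<^sup>2 \<le> 1" using \<eta>2 l1 by (simp add: power_divide)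
      have "r\<^sup>2 * \<eta>\<^sup>2 \<le> 1 * (1/32)" using r2 \<eta>2 by (intro mult_mono) auto
      then show "32 * real (l\<^sup>2) * (r * (\<eta> / real l))\<^sup>2 \<le> 1"
        using l1 by (simp add: power_divide power_mult_distrib)
      have "real n ^ l * (q ^ (l choose 2) * exp (real (l\<^sup>2) * (- \<eta> / real l) ^ 3 * (real l * (real l - 1) * (real l - 2)) / 6
            + 7 * real (l\<^sup>2) * (8 * real l * (- \<eta> / real l)) ^ 4 + 512 * (real l)\<^sup>2 * (real (l\<^sup>2))\<^sup>2 * (- \<eta> / real l) ^ 4))
          + real n ^ k l * ((1 - q) ^ (k l choose 2) * exp (real (l\<^sup>2) * (r * \<eta> / real l) ^ 3 * (real (k l) * (real (k l) - 1) * (real (k l) - 2)) / 6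
            + 7 * real (l\<^sup>2) * (8 * real (k l) * (r * \<eta> / real l)) ^ 4 + 512 * (real (k l))\<^sup>2 * (real (l\<^sup>2))\<^sup>2 * (r * \<eta> / real l) ^ 4))
          \<le> exp ((real l)\<^sup>2 * rate L q (- \<eta>) (real l / real l) (1 / real l))
            + exp ((real l)\<^sup>2 * rate L (1 - q) (r * \<eta>) (real (k l) / real l) (1 / real l))"
        using q l n by (intro add_mono clique_bound_le_rate) auto
      also have "\<dots> < 1" using l0[of l] l by simp
      finally show "real n ^ l * (q ^ (l choose 2) * exp (real (l\<^sup>2) * (- (\<eta> / real l)) ^ 3 * (real l * (real l - 1) * (real l - 2)) / 6
            + 7 * real (l\<^sup>2) * (8 * real l * - (\<eta> / real l)) ^ 4 + 512 * (real l)\<^sup>2 * (real (l\<^sup>2))\<^sup>2 * (- (\<eta> / real l)) ^ 4))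
          + real n ^ k l * ((1 - q) ^ (k l choose 2) * exp (real (l\<^sup>2) * (r * (\<eta> / real l)) ^ 3 * (real (k l) * (real (k l) - 1) * (real (k l) - 2)) / 6
            + 7 * real (l\<^sup>2) * (8 * real (k l) * (r * (\<eta> / real l))) ^ 4 + 512 * (real (k l))\<^sup>2 * (real (l\<^sup>2))\<^sup>2 * (r * (\<eta> / real l)) ^ 4)) < 1"
        by (simp only: minus_divide_left times_divide_eq_right)
    qed (use q \<eta> l kl in auto)
    then show ?thesis using n(2) by linarith
  qed
  show ?thesis
    using \<epsilon> main unfolding M_def k_def by (intro exI[of _ \<epsilon>] conjI exI[of _ "max l0 1"]) auto
qed

end
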